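(* Let $\mathcal{U}$ be a strategic $(p^+)$-filter on $E$. Then every Borel set $\mathbb{A}\subseteq 2^\omega\times E^{[\infty]}$ is perfectly $\mathcal{U}$-strategically Ramsey.
   Context: $F$ is a countable field and $E$ a countably infinite-dimensional $F$-vector space with fixed basis $(e_n)$; $\mathrm{supp}(v)$ is the set of indices of nonzero coefficients of $v\ne0$. Block sequences: sequences of nonzero vectors with $\max\mathrm{supp}(x_n)<\min\mathrm{supp}(x_{n+1})$; $E^{[\infty]}$ (Polish, subspace of $E^\omega$) and $E^{[<\infty]}$ are the infinite and finite ones. $Y\preceq X$ iff $\langle Y\rangle\subseteq\langle X\rangle$; $Y\preceq^*X$ iff some tail of $Y$ is $\preceq X$. Family: nonempty subset of $E^{[\infty]}$ upward closed under $\preceq^*$; filter: family whose any two members have a common $\preceq$-lower bound in it; $\mathcal{H}\restriction X=\{Y\in\mathcal{H}:Y\preceq X\}$. Full: whenever $D\subseteq E$ and $X\in\mathcal{H}$ are such that every $Y\in\mathcal{H}\restriction X$ has some $Z\preceq Y$ with $\langle Z\rangle\subseteq D$, there is $Z\in\mathcal{H}\restriction X$ with $\langle Z\rangle\subseteq D$. $(p)$: every $\preceq$-decreasing sequence in $\mathcal{H}$ has a member of $\mathcal{H}$ that is $\preceq^*$ each term; $(p^+)$-filter: full filter with $(p)$. Strategic: whenever $X\in\mathcal{H}$ and $\alpha$ is a strategy for II in $G[X]$, some outcome of $\alpha$ lies in $\mathcal{H}$. Games for $\vec x\in E^{[<\infty]}$, $X\in E^{[\infty]}$: in $F[\vec x,X]$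 I plays $n_k\in\omega$, II plays nonzero $y_k\in\langle X\rangle$ with $n_k<\min\mathrm{supp}(y_k)$; in $G[\vec x,X]$ I plays $Y_k\in E^{[\infty]}$, $Y_k\preceq X$, II plays nonzero $y_k\in\langle Y_k\rangle$; II's moves are supported above $\vec x$ and form a block sequence; outcome $\vec x^\frown(y_k)$; $G[X]=G[\emptyset,X]$. $[\sigma]$ is the set of outcomes of plays where I follows $\sigma$. $\mathbb{S}$: nonempty perfect subtrees of $2^{<\omega}$ ordered by inclusion; $[p]$ the branches of $p$. $\mathbb{A}$ is perfectly $\mathcal{U}$-strategically Ramsey if for every $\vec x\in E^{[<\infty]}$, $X\in\mathcal{U}$ and $p\in\mathbb{S}$ there are $Y\in\mathcal{U}\restriction X$ and $q\le p$ such that either (i) I has a strategy $\sigma$ in $F[\vec x,Y]$ with $([q]\times[\sigma])\cap\mathbb{A}=\emptyset$, or (ii) for every $f\in[q]$, II has a strategy in $G[\vec x,Y]$ all of whose outcomes lie in $\mathbb{A}_f=\{Z:(f,Z)\in\mathbb{A}\}$. *)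

theory Defs
  imports "HOL-Analysis.Analysis" "HOL-Library.Countable" "HOL-Library.Sublist"
begin

(* E = finitely supported functions nat => F (coordinates w.r.t. the basis (e_n)) *)
type_synonym 'f vec = "nat \<Rightarrow> 'f"
type_synonym 'f bseq = "nat \<Rightarrow> nat \<Rightarrow> 'f"

definition supp :: "('f::zero) vec \<Rightarrow> nat set" where
  "supp v = {n. v n \<noteq> 0}"

definition Evec :: "('f::zero) vec set" where
  "Evec = {v. finite (supp v)}"

definition span_of :: "('f::comm_ring_1) vec set \<Rightarrow> 'f vec set" where
  "span_of S = {v. \<exists>T c. finite T \<and> T \<subseteq> S \<and> v = (\<lambda>i. \<Sum>x\<in>T. c x * x i)}"

definition bspan :: "('f::comm_ring_1) bseq \<Rightarrow> 'f vec set" where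
  "bspan X = span_of (range X)"

definition is_block :: "('f::zero) bseq \<Rightarrow> bool" where
  "is_block X \<longleftrightarrow> (\<forall>n. X n \<in> Evec \<and> supp (X n) \<noteq> {})
      \<and> (\<forall>n. Max (supp (X n)) < Min (supp (X (Suc n))))"

definition Blocks :: "('f::zero) bseq set" where
  "Blocks = {X. is_block X}"

definition is_fin_block :: "('f::zero) vec list \<Rightarrow> bool" where
  "is_fin_block xs \<longleftrightarrow> (\<forall>i<length xs. xs ! i \<in> Evec \<and> supp (xs ! i) \<noteq> {})
      \<and> (\<forall>i. Suc i < length xs \<longrightarrow> Max (supp (xs ! i)) < Min (supp (xs ! Suc i)))"

definition above :: "('f::zero) vec list \<Rightarrow> 'f vec \<Rightarrow> bool" where
  "above xs v \<longleftrightarrow> xs = [] \<or> Max (supp (last xs)) < Min (supp v)"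

definition app :: "'a list \<Rightarrow> (nat \<Rightarrow> 'a) \<Rightarrow> nat \<Rightarrow> 'a" where
  "app xs Y = (\<lambda>n. if n < length xs then xs ! n else Y (n - length xs))"

definition ble :: "('f::comm_ring_1) bseq \<Rightarrow> 'f bseq \<Rightarrow> bool" where
  "ble X Y \<longleftrightarrow> bspan X \<subseteq> bspan Y"

definition ble_star :: "('f::comm_ring_1) bseq \<Rightarrow> 'f bseq \<Rightarrow> bool" where
  "ble_star X Y \<longleftrightarrow> (\<exists>n. ble (\<lambda>k. X (k + n)) Y)"

definition restr :: "('f::comm_ring_1) bseq set \<Rightarrow> 'f bseq \<Rightarrow> 'f bseq set" where
  "restr H X = {Y \<in> H. ble Y X}"

definition is_family :: "('f::comm_ring_1) bseq set \<Rightarrow> bool" where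
  "is_family H \<longleftrightarrow> H \<noteq> {} \<and> H \<subseteq> Blocks
     \<and> (\<forall>X\<in>H. \<forall>Y\<in>Blocks. ble_star X Y \<longrightarrow> Y \<in> H)"

definition is_filter :: "('f::comm_ring_1) bseq set \<Rightarrow> bool" where
  "is_filter H \<longleftrightarrow> is_family H \<and> (\<forall>X\<in>H. \<forall>Y\<in>H. \<exists>Z\<in>H. ble Z X \<and> ble Z Y)"

definition is_full :: "('f::comm_ring_1) bseq set \<Rightarrow> bool" where
  "is_full H \<longleftrightarrow> (\<forall>D X. D \<subseteq> Evec \<longrightarrow> X \<in> H \<longrightarrow>
      (\<forall>Y\<in>restr H X. \<exists>Z\<in>Blocks. ble Z Y \<and> bspan Z \<subseteq> D) \<longrightarrow>
      (\<exists>Z\<in>restr H X. bspan Z \<subseteq> D))"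

definition has_p :: "('f::comm_ring_1) bseq set \<Rightarrow> bool" where
  "has_p H \<longleftrightarrow> (\<forall>Xs :: nat \<Rightarrow> 'f bseq. (\<forall>n. Xs n \<in> H) \<longrightarrow> (\<forall>n. ble (Xs (Suc n)) (Xs n))
      \<longrightarrow> (\<exists>Y\<in>H. \<forall>n. ble_star Y (Xs n)))"

definition pplus_filter :: "('f::comm_ring_1) bseq set \<Rightarrow> bool" where
  "pplus_filter H \<longleftrightarrow> is_filter H \<and> is_full H \<and> has_p H"

(* Game G[xs,X]: a strategy for II maps the list of I's moves Y_0..Y_k to y_k.
   A play by I is a sequence Ys of block sequences with Ys k \<preceq> X. *)
definition I_plays_G :: "('f::comm_ring_1) bseq \<Rightarrow> (nat \<Rightarrow> 'f bseq) set" where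
  "I_plays_G X = {Ys. \<forall>k. Ys k \<in> Blocks \<and> ble (Ys k) X}"

definition II_moves :: "('f bseq list \<Rightarrow> 'f vec) \<Rightarrow> (nat \<Rightarrow> 'f bseq) \<Rightarrow> nat \<Rightarrow> 'f vec" where
  "II_moves \<alpha> Ys k = \<alpha> (map Ys [0..<Suc k])"

definition II_strategy_G :: "('f::comm_ring_1) vec list \<Rightarrow> 'f bseq \<Rightarrow> ('f bseq list \<Rightarrow> 'f vec) \<Rightarrow> bool" where
  "II_strategy_G xs X \<alpha> \<longleftrightarrow> (\<forall>Ys\<in>I_plays_G X.
      (\<forall>k. supp (II_moves \<alpha> Ys k) \<noteq> {} \<and> II_moves \<alpha> Ys k \<in> bspan (Ys k))
      \<and> above xs (II_moves \<alpha> Ys 0)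
      \<and> (\<forall>k. Max (supp (II_moves \<alpha> Ys k)) < Min (supp (II_moves \<alpha> Ys (Suc k)))))"

definition outcomes_G :: "('f::comm_ring_1) vec list \<Rightarrow> 'f bseq \<Rightarrow> ('f bseq list \<Rightarrow> 'f vec) \<Rightarrow> 'f bseq set" where
  "outcomes_G xs X \<alpha> = {app xs (II_moves \<alpha> Ys) | Ys. Ys \<in> I_plays_G X}"

definition strategic :: "('f::comm_ring_1) bseq set \<Rightarrow> bool" where
  "strategic H \<longleftrightarrow> (\<forall>X\<in>H. \<forall>\<alpha>. II_strategy_G [] X \<alpha> \<longrightarrow> (\<exists>Z\<in>outcomes_G [] X \<alpha>. Z \<in> H))"

(* Game F[xs,Y]: a strategy for I maps II's previous moves y_0..y_{k-1} to n_k.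
   [\<sigma>] = outcomes of plays in which I follows \<sigma> (II moving legally). *)
definition outcomes_F :: "('f::comm_ring_1) vec list \<Rightarrow> 'f bseq \<Rightarrow> ('f vec list \<Rightarrow> nat) \<Rightarrow> 'f bseq set" where
  "outcomes_F xs Y \<sigma> = {app xs y | y.
      (\<forall>k. supp (y k) \<noteq> {} \<and> y k \<in> bspan Y \<and> \<sigma> (map y [0..<k]) < Min (supp (y k)))
      \<and> above xs (y 0)
      \<and> (\<forall>k. Max (supp (y k)) < Min (supp (y (Suc k))))}"

definition perfect_tree :: "bool list set \<Rightarrow> bool" where
  "perfect_tree p \<longleftrightarrow> p \<noteq> {} \<and> (\<forall>s\<in>p. \<forall>t. prefix t s \<longrightarrow> t \<in> p)
     \<and> (\<forall>s\<in>p. \<exists>t\<in>p. \<exists>u\<in>p. prefix s t \<and> prefix s u \<and> \<not> prefix t u \<and> \<not> prefix u t)"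

definition branches :: "bool list set \<Rightarrow> (nat \<Rightarrow> bool) set" where
  "branches p = {f. \<forall>n. map f [0..<n] \<in> p}"

definition slice :: "((nat \<Rightarrow> bool) \<times> 'b) set \<Rightarrow> (nat \<Rightarrow> bool) \<Rightarrow> 'b set" where
  "slice A f = {Z. (f, Z) \<in> A}"

definition perfectly_strat_Ramsey ::
  "('f::comm_ring_1) bseq set \<Rightarrow> ((nat \<Rightarrow> bool) \<times> 'f bseq) set \<Rightarrow> bool" where
  "perfectly_strat_Ramsey U A \<longleftrightarrow>
    (\<forall>xs X p. is_fin_block xs \<longrightarrow> X \<in> U \<longrightarrow> perfect_tree p \<longrightarrow>
      (\<exists>Y\<in>restr U X. \<exists>q. perfect_tree q \<and> q \<subseteq> p \<and>
        ((\<exists>\<sigma>. (branches q \<times> outcomes_F xs Y \<sigma>) \<inter> A = {})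
         \<or> (\<forall>f\<in>branches q. \<exists>\<alpha>. II_strategy_G xs Y \<alpha> \<and> outcomes_G xs Y \<alpha> \<subseteq> slice A f))))"

definition Einf_top :: "('f::zero) bseq topology" where
  "Einf_top = subtopology (product_topology (\<lambda>_. discrete_topology Evec) UNIV) Blocks"

definition cantor_top :: "(nat \<Rightarrow> bool) topology" where
  "cantor_top = product_topology (\<lambda>_. discrete_topology UNIV) UNIV"

definition borel_sets :: "'a topology \<Rightarrow> 'a set set" where
  "borel_sets T = sigma_sets (topspace T) {U. openin T U}"

end

theory Submission
  imports Defs
begin

text \<open>
  Everything in the two games depends on \<open>Y\<close> only up to almost inclusion, so \<open>(p)\<close> makes the filter
  countably closed, and countably many dense requirements on pairs (perfect tree, member of \<open>U\<close>)
  can be met by one fusion.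

  The key point is that fullness survives in a Sacks extension: if \<open>f \<mapsto> D f\<close> is such that \<open>y \<notin> D f\<close> is an
  open condition on \<open>f\<close>, then on some perfect subtree either a single \<open>Y \<in> U\<close> has its span inside
  every \<open>D f\<close>, or no block subsequence of \<open>Y\<close> has its span inside any \<open>D f\<close>. If the second
  alternative fails, fullness of \<open>U\<close> supplies, after any finite list of vectors, a member of \<open>U\<close> every
  vector of which can be added to the list at the cost of shrinking finitely many subtrees; because
  \<open>U\<close> is strategic, some sequence of such choices belongs to \<open>U\<close>.

  A Borel set is a projection of a closed set along \<open>b \<in> \<omega>\<^sup>\<omega>\<close>. As in Rosendal's proof for analytic
  sets, label positions \<open>x\<close> by finite approximations \<open>s\<close> of \<open>b\<close>. If I cannot avoid the part of the set
  with label \<open>s\<close>, on any subtree, then on a subtree II can force the game in finitely many moves to a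
  position where I cannot avoid the part with some label \<open>s @ [n]\<close>; otherwise forced fullness gives
  I a strategy to stay where all these parts are avoidable and then to avoid all of them. Iterating,
  II builds the outcome together with a witness \<open>b\<close>.
\<close>

section \<open>Perfect trees\<close>

abbreviation ini :: "(nat \<Rightarrow> 'a) \<Rightarrow> nat \<Rightarrow> 'a list" where
  "ini f n \<equiv> map f [0..<n]"

lemma prefix_same_length_eq: "prefix s t \<Longrightarrow> length s = length t \<Longrightarrow> s = t"
  by (auto simp: prefix_def)

lemma take_ini: "m \<le> n \<Longrightarrow> take m (ini f n) = ini f m"
  by (simp add: take_map)

lemma prefix_ini: "m \<le> n \<Longrightarrow> prefix (ini f m) (ini f n)"
  by (metis take_ini take_is_prefix)

definition tcone :: "bool list set \<Rightarrow> bool list \<Rightarrow> bool list set" where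
  "tcone p t = {u \<in> p. prefix u t \<or> prefix t u}"

lemma tcone_subset: "tcone p t \<subseteq> p"
  by (auto simp: tcone_def)

lemma tcone_mono: "q \<subseteq> p \<Longrightarrow> tcone q t \<subseteq> tcone p t"
  by (auto simp: tcone_def)

lemma perfect_tree_prefix: "perfect_tree p \<Longrightarrow> s \<in> p \<Longrightarrow> prefix t s \<Longrightarrow> t \<in> p"
  unfolding perfect_tree_def by blast

lemma perfect_tree_tcone:
  assumes p: "perfect_tree p" and t: "t \<in> p"
  shows "perfect_tree (tcone p t)"
  unfolding perfect_tree_def
proof (intro conjI ballI allI impI)
  show "tcone p t \<noteq> {}" using t by (auto simp: tcone_def)
next
  fix s u assume "s \<in> tcone p t" "prefix u s"
  then show "u \<in> tcone p t"
    using perfect_tree_prefix[OF p] prefix_same_cases[of u s t] prefix_order.trans[of u s t]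
    unfolding tcone_def by blast
next
  fix s assume s: "s \<in> tcone p t"
  \<comment> \<open>The longer of the two comparable nodes: incomparable extensions of
    \<open>w\<close> lie above both \<open>s\<close> and \<open>t\<close>, hence stay in the cone
    and split \<open>s\<close>.\<close>
  define w where "w = (if prefix s t then t else s)"
  have w: "w \<in> p" "prefix s w" "prefix t w"
    using s t by (auto simp: tcone_def w_def)
  obtain a b where ab: "a \<in> p" "b \<in> p" "prefix w a" "prefix w b" "\<not> prefix a b" "\<not> prefix b a"
    using p w(1) unfolding perfect_tree_def by blast
  have "a \<in> tcone p t" "b \<in> tcone p t"
    using ab prefix_order.trans[OF w(3)] by (auto simp: tcone_def)
  then show "\<exists>a\<in>tcone p t. \<exists>b\<in>tcone p t. prefix s a \<and> prefix s b \<and> \<not> prefix a b \<and> \<not> prefix b a"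
    using ab prefix_order.trans[OF w(2)] by blast
qed

lemma perfect_tree_extend:
  assumes "perfect_tree p" "s \<in> p"
  shows "\<exists>b. s @ [b] \<in> p"
proof -
  obtain a b where ab: "a \<in> p" "b \<in> p" "prefix s a" "prefix s b" "\<not> prefix a b"
    using assms unfolding perfect_tree_def by blast
  then have "a \<noteq> s" by auto
  then obtain c cs where "a = s @ c # cs"
    using ab(3) by (metis append_Nil2 list.exhaust prefix_def)
  then show ?thesis
    using perfect_tree_prefix[OF assms(1) ab(1), of "s @ [c]"] by auto
qed

lemma branches_nonempty:
  assumes p: "perfect_tree p"
  shows "branches p \<noteq> {}"
proof -
  define S where "S = rec_nat [] (\<lambda>_ s. s @ [SOME b. s @ [b] \<in> p])"
  have nil: "[] \<in> p"
    using p perfect_tree_prefix[OF p] unfolding perfect_tree_def by (metis Nil_prefix ex_in_conv)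
  have Sp: "S n \<in> p" for n
  proof (induction n)
    case (Suc n)
    show ?case using someI_ex[OF perfect_tree_extend[OF p Suc]] by (simp add: S_def)
  qed (simp add: S_def nil)
  have "ini (\<lambda>n. SOME b. S n @ [b] \<in> p) n = S n" for n
    by (induction n) (simp_all add: S_def)
  then have "(\<lambda>n. SOME b. S n @ [b] \<in> p) \<in> branches p"
    using Sp by (simp add: branches_def)
  then show ?thesis by blast
qed

lemma branches_mono: "q \<subseteq> p \<Longrightarrow> branches q \<subseteq> branches p"
  by (auto simp: branches_def)

lemma ini_in_tree: "f \<in> branches p \<Longrightarrow> ini f n \<in> p"
  by (auto simp: branches_def)

lemma branches_tcone: "f \<in> branches p \<Longrightarrow> f \<in> branches (tcone p (ini f n))"
proof -
  assume f: "f \<in> branches p"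
  have "ini f m \<in> tcone p (ini f n)" for m
    using ini_in_tree[OF f] nat_le_linear[of m n] prefix_ini by (auto simp: tcone_def)
  then show ?thesis by (simp add: branches_def)
qed

lemma branches_tconeD:
  assumes "f \<in> branches (tcone p t)"
  shows "f \<in> branches p" "ini f (length t) = t"
proof -
  show "f \<in> branches p" using assms branches_mono[OF tcone_subset] by blast
  have "prefix (ini f (length t)) t \<or> prefix t (ini f (length t))"
    using ini_in_tree[OF assms, of "length t"] by (auto simp: tcone_def)
  then show "ini f (length t) = t"
    by (elim disjE) (use prefix_same_length_eq in fastforce)+
qed

lemma tcone_antimono: "prefix t u \<Longrightarrow> tcone p u \<subseteq> tcone p t"
proof
  fix x assume tu: "prefix t u" and "x \<in> tcone p u"
  then have "x \<in> p" "prefix x u \<or> prefix u x" by (auto simp: tcone_def)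
  then show "x \<in> tcone p t"
    using prefix_order.trans[OF tu] prefix_same_cases[OF _ tu, of x] by (auto simp: tcone_def)
qed

lemma tcone_ini_antimono: "m \<le> n \<Longrightarrow> tcone p (ini f n) \<subseteq> tcone p (ini f m)"
  by (simp add: tcone_antimono prefix_ini)

lemma perfect_tcone_ini: "perfect_tree p \<Longrightarrow> f \<in> branches p \<Longrightarrow> perfect_tree (tcone p (ini f n))"
  by (simp add: perfect_tree_tcone ini_in_tree)

text \<open>A perfect subtree of a cone has nodes of arbitrary length, so it contains the vertex of the cone.\<close>
lemma vertex_in_subtree:
  assumes "perfect_tree q" "q \<subseteq> tcone p t"
  shows "t \<in> q"
proof -
  obtain f where f: "f \<in> branches q" using branches_nonempty[OF assms(1)] by blast
  then have "f \<in> branches (tcone p t)" using branches_mono[OF assms(2)] by blast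
  then show ?thesis using branches_tconeD(2) ini_in_tree[OF f] by metis
qed

section \<open>Splitting and fusion of perfect trees\<close>

definition split_node :: "bool list set \<Rightarrow> bool \<Rightarrow> bool list" where
  "split_node q = (SOME v. (\<forall>b. v b \<in> q) \<and> \<not> prefix (v True) (v False) \<and> \<not> prefix (v False) (v True))"

lemma split_node:
  assumes "perfect_tree q"
  shows "split_node q b \<in> q" "\<not> prefix (split_node q b) (split_node q (\<not> b))"
proof -
  obtain s where "s \<in> q" using assms unfolding perfect_tree_def by blast
  then obtain t u where "t \<in> q" "u \<in> q" "\<not> prefix t u" "\<not> prefix u t"
    using assms unfolding perfect_tree_def by blast
  then have "\<exists>v. (\<forall>b. v b \<in> q) \<and> \<not> prefix (v True) (v False) \<and> \<not> prefix (v False) (v True)"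
    by (intro exI[of _ "\<lambda>b. if b then t else u"]) auto
  from someI_ex[OF this, folded split_node_def]
  show "split_node q b \<in> q" "\<not> prefix (split_node q b) (split_node q (\<not> b))" by (cases b; simp)+
qed

text \<open>Bit lists carry the newest bit first, so \<open>R (b # s)\<close> is a child of
  \<open>R s\<close>. The fusion is the downward closure of the stems \<open>u s\<close>. Beyond the
  longest stem of level \<open>n\<close>, a node of the fusion extends exactly one stem
  \<open>u s\<close> with \<open>length s = n\<close>, and all nodes above that stem come from
  extensions of \<open>s\<close>, hence lie in \<open>R s\<close>.\<close>

lemma fusion_scheme:
  assumes R: "\<And>s. perfect_tree (R s)"
    and step: "\<And>b s. R (b # s) \<subseteq> tcone (R s) (split_node (R s) b)"
  shows "\<exists>q. perfect_tree q \<and> q \<subseteq> R [] \<and>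
    (\<forall>n. \<exists>N. \<forall>t\<in>q. length t = N \<longrightarrow> (\<exists>s. length s = n \<and> tcone q t \<subseteq> R s))"
proof -
  \<comment> \<open>\<open>u s\<close> is the node whose cone was taken on entering
    \<open>R s\<close>; the root has the empty stem.\<close>
  define u where "u s = (case s of [] \<Rightarrow> [] | b # s \<Rightarrow> split_node (R s) b)" for s
  have uR: "u s \<in> R s" for s
  proof (cases s)
    case Nil
    then show ?thesis
      using R[of "[]"] perfect_tree_prefix[OF R] unfolding perfect_tree_def u_def by auto
  next
    case (Cons b s')
    then show ?thesis using vertex_in_subtree[OF R step] by (simp add: u_def)
  qed
  have uR': "u (b # s) \<in> R s" for b s using split_node(1)[OF R] by (simp add: u_def)
  have Rsub: "R (b # s) \<subseteq> R s" for b s using step tcone_subset by blast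
  have Rapp: "R (s' @ s) \<subseteq> R s" for s' s
    by (induction s') (use Rsub in auto)
  have inc: "\<not> prefix (u (b # s)) (u ((\<not> b) # s))" for b s
    using split_node(2)[OF R] by (simp add: u_def)
  have comp: "prefix (u (b # s)) (u s) \<or> prefix (u s) (u (b # s))" for b s
  proof (cases s)
    case (Cons c s')
    have "u (b # s) \<in> tcone (R s') (u s)"
      using uR'[of b s] step[of c s'] by (auto simp: Cons u_def)
    then show ?thesis by (auto simp: tcone_def)
  qed (simp add: u_def)
  \<comment> \<open>Both successors of \<open>u s\<close> are comparable with it and incomparable
    with each other. If one of them were below \<open>u s\<close>, then whichever way the other
    compares with \<open>u s\<close>, the two would be comparable.\<close>
  have ext: "prefix (u s) (u (b # s))" for b s
  proof (rule ccontr)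
    assume "\<not> prefix (u s) (u (b # s))"
    then have 1: "prefix (u (b # s)) (u s)" using comp by blast
    from comp[of "\<not> b" s] show False
    proof
      assume "prefix (u ((\<not> b) # s)) (u s)"
      from prefix_same_cases[OF 1 this] show False using inc[of b s] inc[of "\<not> b" s] by simp
    next
      assume "prefix (u s) (u ((\<not> b) # s))"
      then show False using prefix_order.trans[OF 1] inc by blast
    qed
  qed
  have extapp: "prefix (u s) (u (s' @ s))" for s' s
  proof (induction s')
    case (Cons b s')
    then show ?case using prefix_order.trans[OF _ ext] by simp
  qed simp
  have sep: "s = s'" if "length s = length s'" "prefix (u s) v" "prefix (u s') v" for s s' v
    using that
  proof (induction s s' rule: list_induct2)
    case (Cons b s c s')
    have "s = s'"
      using Cons.IH prefix_order.trans[OF ext Cons.prems(1)] prefix_order.trans[OF ext Cons.prems(2)] .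
    moreover have "b = c"
    proof (rule ccontr)
      assume "b \<noteq> c"
      then have "c = (\<not> b)" by auto
      then show False
        using Cons.prems \<open>s = s'\<close> inc[of b s] inc[of c s] prefix_same_cases[of "u (b # s)" v "u (c # s)"]
        by auto
    qed
    ultimately show ?case by simp
  qed simp
  define q where "q = {t. \<exists>s. prefix t (u s)}"
  have qlong: "\<exists>s. length s \<ge> n \<and> prefix t (u s)" if t: "t \<in> q" for t n
  proof -
    obtain s where "prefix t (u s)" using t q_def by blast
    then show ?thesis
      using prefix_order.trans[OF _ extapp[of s "replicate n True"]]
      by (intro exI[of _ "replicate n True @ s"]) auto
  qed
  have "perfect_tree q"
    unfolding perfect_tree_def
  proof (intro conjI ballI allI impI)
    show "q \<noteq> {}" unfolding q_def by blast
  next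
    fix s t assume "s \<in> q" "prefix t s"
    then show "t \<in> q" unfolding q_def using prefix_order.trans[of t s] by blast
  next
    fix t assume "t \<in> q"
    then obtain s where "prefix t (u s)" unfolding q_def by blast
    then have "prefix t (u (b # s))" for b using prefix_order.trans[OF _ ext] by blast
    moreover have "u s \<in> q" for s unfolding q_def by blast
    ultimately show "\<exists>a\<in>q. \<exists>b\<in>q. prefix t a \<and> prefix t b \<and> \<not> prefix a b \<and> \<not> prefix b a"
      using inc[of True s] inc[of False s]
      by (intro bexI[of _ "u (True # s)"] bexI[of _ "u (False # s)"]) auto
  qed
  moreover have "q \<subseteq> R []"
  proof
    fix t assume "t \<in> q"
    then obtain s where "prefix t (u s)" unfolding q_def by blast
    moreover have "u s \<in> R []" using uR[of s] Rapp[of s "[]"] by auto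
    ultimately show "t \<in> R []" using perfect_tree_prefix[OF R] by blast
  qed
  moreover have "\<exists>N. \<forall>t\<in>q. length t = N \<longrightarrow> (\<exists>s. length s = n \<and> tcone q t \<subseteq> R s)" for n
  proof -
    have fin: "finite {s::bool list. length s = n}"
      using finite_lists_length_eq[of "UNIV :: bool set" n] by simp
    \<comment> \<open>A node of length \<open>N\<close> is at least as long as every stem of level
      \<open>n\<close>, so it extends the stem with which it is comparable.\<close>
    define N where "N = Max ((\<lambda>s. length (u s)) ` {s. length s = n})"
    have N: "length (u s) \<le> N" if "length s = n" for s
      unfolding N_def using fin that by (intro Max_ge) auto
    have key: "v \<in> R s" if v: "v \<in> q" and s: "length s = n" and pre: "prefix (u s) v" for v s
    proof -
      obtain s' where s': "length s' \<ge> n" "prefix v (u s')" using qlong[OF v] by blast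
      obtain s1 s2 where s12: "s' = s1 @ s2" "length s2 = n"
        using s'(1) by (metis append_take_drop_id diff_diff_cancel length_drop)
      have "s2 = s"
        using sep[of s2 s "u s'"] extapp[of s2 s1] s12 s prefix_order.trans[OF pre s'(2)] by simp
      then have "u s' \<in> R s" using uR[of s'] Rapp[of s1 s2] s12 by auto
      then show ?thesis using perfect_tree_prefix[OF R] s'(2) by blast
    qed
    have "\<exists>s. length s = n \<and> tcone q t \<subseteq> R s" if t: "t \<in> q" "length t = N" for t
    proof -
      obtain s' where s': "length s' \<ge> n" "prefix t (u s')" using qlong[OF t(1)] by blast
      obtain s1 s where s12: "s' = s1 @ s" "length s = n"
        using s'(1) by (metis append_take_drop_id diff_diff_cancel length_drop)
      have pre: "prefix (u s) t"
        using extapp[of s s1] s12 s'(2) N[OF s12(2)] t(2) by (metis prefix_length_prefix)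
      have "tcone q t \<subseteq> R s"
      proof
        fix v assume v: "v \<in> tcone q t"
        then consider "prefix v t" | "prefix t v" "v \<in> q" by (auto simp: tcone_def)
        then show "v \<in> R s"
        proof cases
          case 1
          then show ?thesis using key[OF t(1) s12(2) pre] perfect_tree_prefix[OF R] by blast
        next
          case 2
          then show ?thesis using key[OF 2(2) s12(2)] prefix_order.trans[OF pre 2(1)] by blast
        qed
      qed
      then show ?thesis using s12 by blast
    qed
    then show ?thesis by blast
  qed
  ultimately show ?thesis by blast
qed

section \<open>Spans of block sequences\<close>

lemma span_of_mono: "S \<subseteq> S' \<Longrightarrow> span_of S \<subseteq> span_of S'"
  unfolding span_of_def by blast

lemma span_of_base: "x \<in> S \<Longrightarrow> x \<in> span_of S"
  unfolding span_of_def by (auto intro!: exI[of _ "{x}"] exI[of _ "\<lambda>_. 1"])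

lemma span_of_zero: "(\<lambda>_. 0) \<in> span_of S"
  unfolding span_of_def by (auto intro!: exI[of _ "{}"])

lemma span_of_add_scale:
  assumes "v \<in> span_of S" "w \<in> span_of S"
  shows "(\<lambda>i. v i + a * w i) \<in> span_of S"
proof -
  obtain T c T' c' where T: "finite T" "T \<subseteq> S" "v = (\<lambda>i. \<Sum>x\<in>T. c x * x i)"
    and T': "finite T'" "T' \<subseteq> S" "w = (\<lambda>i. \<Sum>x\<in>T'. c' x * x i)"
    using assms unfolding span_of_def by blast
  define d where "d x = (if x \<in> T then c x else 0) + a * (if x \<in> T' then c' x else 0)" for x
  have "v i = (\<Sum>x\<in>T \<union> T'. (if x \<in> T then c x else 0) * x i)" for i
    unfolding T(3) using T(1) T'(1) by (intro sum.mono_neutral_cong_left) auto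
  moreover have "w i = (\<Sum>x\<in>T \<union> T'. (if x \<in> T' then c' x else 0) * x i)" for i
    unfolding T'(3) using T(1) T'(1) by (intro sum.mono_neutral_cong_left) auto
  ultimately have "(\<lambda>i. v i + a * w i) = (\<lambda>i. \<Sum>x\<in>T \<union> T'. d x * x i)"
    by (auto simp: d_def sum.distrib sum_distrib_left algebra_simps)
  then show ?thesis
    using T T' unfolding span_of_def by blast
qed

lemma span_of_minimal:
  assumes "S \<subseteq> span_of S'"
  shows "span_of S \<subseteq> span_of S'"
proof
  fix v assume "v \<in> span_of S"
  then obtain T c where T: "finite T" "T \<subseteq> S" "v = (\<lambda>i. \<Sum>x\<in>T. c x * x i)"
    unfolding span_of_def by blast
  have "(\<lambda>i. \<Sum>x\<in>T. c x * x i) \<in> span_of S'"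
    using T(1,2)
  proof (induction T)
    case empty
    then show ?case by (simp add: span_of_zero)
  next
    case (insert x T)
    then have "(\<lambda>i. (\<Sum>x\<in>T. c x * x i) + c x * x i) \<in> span_of S'"
      using assms by (intro span_of_add_scale) auto
    then show ?case using insert by (simp add: add.commute)
  qed
  then show "v \<in> span_of S'" using T by simp
qed

lemma ble_refl: "ble X X"
  by (simp add: ble_def)

lemma ble_trans: "ble X Y \<Longrightarrow> ble Y Z \<Longrightarrow> ble X Z"
  by (auto simp: ble_def)

lemma ble_imp_star: "ble X Y \<Longrightarrow> ble_star X Y"
  unfolding ble_star_def by (intro exI[of _ 0]) simp

lemma block_mono:
  assumes "X \<in> Blocks" "m < n"
  shows "Max (supp (X m)) < Min (supp (X n))"
  using assms(2)
proof (induction rule: less_Suc_induct)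
  case (2 i j k)
  have "supp (X j) \<noteq> {}" "finite (supp (X j))"
    using assms(1) by (auto simp: Blocks_def is_block_def Evec_def)
  then have "Min (supp (X j)) \<le> Max (supp (X j))" by simp
  then show ?case using 2 by linarith
qed (use assms(1) in \<open>auto simp: Blocks_def is_block_def\<close>)

lemma block_fin: "X \<in> Blocks \<Longrightarrow> finite (supp (X n)) \<and> supp (X n) \<noteq> {}"
  by (auto simp: Blocks_def is_block_def Evec_def)

lemma block_coord_less:
  assumes "X \<in> Blocks" "m < n" "X m i \<noteq> 0" "X n j \<noteq> 0"
  shows "i < j"
proof -
  have "i \<le> Max (supp (X m))" "Min (supp (X n)) \<le> j"
    using assms block_fin[OF assms(1)] by (auto simp: supp_def intro!: Max_ge Min_le)
  then show ?thesis using block_mono[OF assms(1,2)] by linarith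
qed

lemma block_coord_ge: "X \<in> Blocks \<Longrightarrow> X n i \<noteq> 0 \<Longrightarrow> n \<le> i"
proof (induction n arbitrary: i)
  case (Suc n)
  obtain j where "X n j \<noteq> 0" using block_fin[OF Suc.prems(1), of n] by (auto simp: supp_def)
  then show ?case
    using Suc.IH[OF Suc.prems(1)] block_coord_less[OF Suc.prems(1) lessI _ Suc.prems(2)] by fastforce
qed simp

lemma tail_Blocks: "X \<in> Blocks \<Longrightarrow> (\<lambda>k. X (k + n)) \<in> Blocks"
  by (auto simp: Blocks_def is_block_def)

lemma ble_tail: "ble (\<lambda>k. X (k + n)) X"
  unfolding ble_def bspan_def by (intro span_of_mono) auto

lemma span_coord: "v \<in> span_of S \<Longrightarrow> v i \<noteq> 0 \<Longrightarrow> \<exists>x\<in>S. x i \<noteq> 0"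
proof -
  assume "v \<in> span_of S" and i: "v i \<noteq> 0"
  then obtain T c where T: "T \<subseteq> S" "v = (\<lambda>i. \<Sum>x\<in>T. c x * x i)"
    unfolding span_of_def by blast
  then obtain x where "x \<in> T" "c x * x i \<noteq> 0"
    using i by (metis (no_types, lifting) sum.neutral)
  then show ?thesis using T by (metis mult_zero_right subsetD)
qed

lemma span_Evec:
  assumes "S \<subseteq> Evec" shows "span_of S \<subseteq> Evec"
proof
  fix v assume "v \<in> span_of S"
  then obtain T c where T: "finite T" "T \<subseteq> S" "v = (\<lambda>i. \<Sum>x\<in>T. c x * x i)"
    unfolding span_of_def by blast
  have "v \<in> span_of T" using T unfolding span_of_def by blast
  then have "supp v \<subseteq> (\<Union>x\<in>T. supp x)"
    using span_coord by (fastforce simp: supp_def)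
  moreover have "finite (\<Union>x\<in>T. supp x)" using T assms by (auto simp: Evec_def)
  ultimately show "v \<in> Evec" unfolding Evec_def using finite_subset by blast
qed

lemma bspan_Evec: "X \<in> Blocks \<Longrightarrow> bspan X \<subseteq> Evec"
  unfolding bspan_def by (intro span_Evec) (auto simp: Blocks_def is_block_def)

lemma block_in_bspan: "X n \<in> bspan X"
  unfolding bspan_def by (simp add: span_of_base)

section \<open>Tails, vectors of far support and almost inclusion\<close>

lemma tail_far:
  assumes "X \<in> Blocks" "v \<in> bspan (\<lambda>k. X (k + n))" "i < n"
  shows "v i = 0"
  using span_coord[OF assms(2)[unfolded bspan_def], of i] block_coord_ge[OF assms(1)] assms(3)
  by fastforce

text \<open>The supports of distinct blocks are disjoint, so a coefficient can be read off at any
  coordinate in the support of its block. A block before \<open>X n\<close> has its support below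
  \<open>Max (supp (X n))\<close>, where \<open>v\<close> vanishes; its coefficient is therefore
  0.\<close>

lemma far_in_tail:
  fixes X :: "('f::field) bseq"
  assumes X: "X \<in> Blocks"
  shows "\<exists>m. \<forall>v\<in>bspan X. (\<forall>i\<le>m. v i = 0) \<longrightarrow> v \<in> bspan (\<lambda>k. X (k + n))"
proof (intro exI ballI impI)
  fix v assume v: "v \<in> bspan X" and far: "\<forall>i\<le>Max (supp (X n)). v i = 0"
  obtain T c where T: "finite T" "T \<subseteq> range X" "v = (\<lambda>i. \<Sum>x\<in>T. c x * x i)"
    using v unfolding bspan_def span_of_def by blast
  define T' where "T' = T \<inter> range (\<lambda>k. X (k + n))"
  have "c x = 0" if x: "x \<in> T - T'" for x
  proof -
    obtain j where j: "x = X j" using x T(2) by blast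
    then have "\<not> n \<le> j"
      using x by (auto simp: T'_def image_iff) (metis le_add_diff_inverse2)
    then have "j < n" by simp
    obtain i where i: "X j i \<noteq> 0" using block_fin[OF X, of j] by (auto simp: supp_def)
    have "i \<le> Max (supp (X n))"
    proof -
      obtain l where l: "X n l \<noteq> 0" using block_fin[OF X, of n] by (auto simp: supp_def)
      then have "l \<le> Max (supp (X n))" using block_fin[OF X, of n] by (auto simp: supp_def)
      then show ?thesis using block_coord_less[OF X \<open>j < n\<close> i l] by linarith
    qed
    then have "v i = 0" using far by blast
    moreover have "v i = c x * x i"
    proof -
      have "y i = 0" if "y \<in> T" "y \<noteq> x" for y
      proof (rule ccontr)
        assume y: "y i \<noteq> 0"
        obtain k where k: "y = X k" using \<open>y \<in> T\<close> T(2) by blast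
        then have "k \<noteq> j" using that j by blast
        then show False
          using block_coord_less[OF X, of j k i i] block_coord_less[OF X, of k j i i] y i k
          by (metis less_irrefl linorder_neqE_nat)
      qed
      then have "v i = (\<Sum>y\<in>T. if y = x then c x * x i else 0)"
        unfolding T(3) by (intro sum.cong) auto
      then show ?thesis using x T(1) by simp
    qed
    ultimately show "c x = 0" using i j by simp
  qed
  then have "v = (\<lambda>i. \<Sum>x\<in>T'. c x * x i)"
    unfolding T(3) using T(1) by (intro ext sum.mono_neutral_right) (auto simp: T'_def)
  moreover have "finite T'" "T' \<subseteq> range (\<lambda>k. X (k + n))" using T(1) by (auto simp: T'_def)
  ultimately show "v \<in> bspan (\<lambda>k. X (k + n))" unfolding bspan_def span_of_def by blast
qed

text \<open>Tails are traded for vectors of far support. This form makes transitivity immediate and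
  fits the games, where I can force the vectors of II to be far out.\<close>

lemma ble_star_iff:
  fixes X :: "('f::field) bseq"
  assumes X: "X \<in> Blocks"
  shows "ble_star X Y \<longleftrightarrow> (\<exists>m. \<forall>v\<in>bspan X. (\<forall>i\<le>m. v i = 0) \<longrightarrow> v \<in> bspan Y)"
proof
  assume "ble_star X Y"
  then obtain n where "bspan (\<lambda>k. X (k + n)) \<subseteq> bspan Y"
    by (auto simp: ble_star_def ble_def)
  then show "\<exists>m. \<forall>v\<in>bspan X. (\<forall>i\<le>m. v i = 0) \<longrightarrow> v \<in> bspan Y"
    using far_in_tail[OF X, of n] by blast
next
  assume "\<exists>m. \<forall>v\<in>bspan X. (\<forall>i\<le>m. v i = 0) \<longrightarrow> v \<in> bspan Y"
  then obtain m where m: "\<forall>v\<in>bspan X. (\<forall>i\<le>m. v i = 0) \<longrightarrow> v \<in> bspan Y" by blast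
  have "bspan (\<lambda>k. X (k + Suc m)) \<subseteq> bspan Y"
  proof
    fix v assume v: "v \<in> bspan (\<lambda>k. X (k + Suc m))"
    then have "v \<in> bspan X" using ble_tail[of X "Suc m"] by (auto simp: ble_def)
    then show "v \<in> bspan Y" using m tail_far[OF X v] by auto
  qed
  then show "ble_star X Y" unfolding ble_star_def ble_def by blast
qed

lemma ble_star_trans:
  fixes X :: "('f::field) bseq"
  assumes "X \<in> Blocks" "Y \<in> Blocks" "ble_star X Y" "ble_star Y Z"
  shows "ble_star X Z"
proof -
  obtain m m' where "\<forall>v\<in>bspan X. (\<forall>i\<le>m. v i = 0) \<longrightarrow> v \<in> bspan Y"
    "\<forall>v\<in>bspan Y. (\<forall>i\<le>m'. v i = 0) \<longrightarrow> v \<in> bspan Z"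
    using assms by (auto simp: ble_star_iff)
  then have "\<forall>v\<in>bspan X. (\<forall>i\<le>max m m'. v i = 0) \<longrightarrow> v \<in> bspan Z" by auto
  then show ?thesis using assms ble_star_iff by blast
qed

lemma ble_star_tail:
  fixes X :: "('f::field) bseq"
  assumes "X \<in> Blocks"
  shows "ble_star X (\<lambda>k. X (k + n))"
  using far_in_tail[OF assms, of n] ble_star_iff[OF assms] by blast

text \<open>Used to pass conditions of the form "for all \<open>Z\<close> below \<open>X\<close>"
  down to \<open>Y\<close>: such a condition is applied to a tail of \<open>Z\<close>.\<close>

lemma ble_star_restrict:
  fixes Y :: "('f::field) bseq"
  assumes "ble_star Y X" "Z \<in> Blocks" "Y \<in> Blocks" "ble Z Y"
  obtains n where "(\<lambda>k. Z (k + n)) \<in> Blocks" "ble (\<lambda>k. Z (k + n)) X"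
proof -
  have "ble_star Z X" using ble_star_trans[OF assms(2,3) ble_imp_star[OF assms(4)] assms(1)] .
  then show thesis using that tail_Blocks[OF assms(2)] unfolding ble_star_def by blast
qed

lemma less_Min_supp_iff:
  assumes "v \<in> Evec" "supp v \<noteq> {}"
  shows "m < Min (supp v) \<longleftrightarrow> (\<forall>i\<le>m. v i = 0)"
  using assms by (auto simp: Evec_def supp_def not_le)

lemma block_far_vector:
  assumes "Z \<in> Blocks"
  shows "\<exists>v\<in>bspan Z. supp v \<noteq> {} \<and> m < Min (supp v)"
proof (intro bexI conjI)
  show "supp (Z (Suc m)) \<noteq> {}" using block_fin[OF assms] by blast
  moreover have "Z (Suc m) \<in> Evec" using assms by (auto simp: Blocks_def is_block_def)
  ultimately show "m < Min (supp (Z (Suc m)))"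
    using block_coord_ge[OF assms, of "Suc m"] by (subst less_Min_supp_iff) (fastforce)+
qed (rule block_in_bspan)

section \<open>Countability of vectors and of finite block sequences\<close>

lemma countable_Evec: "countable (Evec :: ('f::{zero,countable}) vec set)"
proof -
  have "(Evec :: 'f vec set) \<subseteq> range (\<lambda>l i. if i < length l then l ! i else 0)"
  proof
    fix v :: "'f vec" assume "v \<in> Evec"
    then obtain n where n: "\<forall>i\<in>supp v. i < n"
      unfolding Evec_def using finite_nat_set_iff_bounded by blast
    have "v = (\<lambda>i. if i < length (ini v n) then ini v n ! i else 0)"
      using n by (fastforce simp: supp_def)
    then show "v \<in> range (\<lambda>l i. if i < length l then l ! i else 0)" by blast
  qed
  from countable_subset[OF this] show ?thesis by simp
qed

definition FBlocks :: "('f::zero) vec list set" where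
  "FBlocks = {xs. is_fin_block xs}"

lemma countable_FBlocks: "countable (FBlocks :: ('f::{zero,countable}) vec list set)"
proof (rule countable_subset)
  show "(FBlocks :: 'f vec list set) \<subseteq> lists Evec"
    by (auto simp: FBlocks_def is_fin_block_def in_set_conv_nth)
  show "countable (lists (Evec :: 'f vec set))"
    using countable_lists countable_Evec by blast
qed

lemma FBlocks_snoc:
  assumes "xs \<in> FBlocks" "y \<in> Evec" "supp y \<noteq> {}" "above xs y"
  shows "xs @ [y] \<in> FBlocks"
  unfolding FBlocks_def is_fin_block_def mem_Collect_eq
proof (intro conjI allI impI)
  fix i assume "i < length (xs @ [y])"
  then show "(xs @ [y]) ! i \<in> Evec" "supp ((xs @ [y]) ! i) \<noteq> {}"
    using assms by (auto simp: FBlocks_def is_fin_block_def nth_append less_Suc_eq)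
next
  fix i assume i: "Suc i < length (xs @ [y])"
  show "Max (supp ((xs @ [y]) ! i)) < Min (supp ((xs @ [y]) ! Suc i))"
  proof (cases "Suc i < length xs")
    case True
    then show ?thesis using assms(1) by (auto simp: FBlocks_def is_fin_block_def nth_append)
  next
    case False
    then have "Suc i = length xs" using i by simp
    then show ?thesis using assms(4)
      by (cases xs rule: rev_cases) (auto simp: above_def nth_append)
  qed
qed

section \<open>Fusion and forced fullness\<close>

locale strategic_pplus =
  fixes U :: "('f::{field,countable}) bseq set"
  assumes strat: "strategic U" and pp: "pplus_filter U"
begin

lemma U_Blocks: "X \<in> U \<Longrightarrow> X \<in> Blocks"
  using pp by (auto simp: pplus_filter_def is_filter_def is_family_def)

lemma U_upward: "X \<in> U \<Longrightarrow> Y \<in> Blocks \<Longrightarrow> ble_star X Y \<Longrightarrow> Y \<in> U"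
  using pp by (auto simp: pplus_filter_def is_filter_def is_family_def)

lemma U_lower: "X \<in> U \<Longrightarrow> Y \<in> U \<Longrightarrow> \<exists>Z\<in>U. ble Z X \<and> ble Z Y"
  using pp by (auto simp: pplus_filter_def is_filter_def)

lemma U_nonempty: "\<exists>X. X \<in> U"
  using pp by (auto simp: pplus_filter_def is_filter_def is_family_def)

lemma U_full:
  assumes "D \<subseteq> Evec" "X \<in> U"
    and "\<And>Y. Y \<in> U \<Longrightarrow> ble Y X \<Longrightarrow> \<exists>Z\<in>Blocks. ble Z Y \<and> bspan Z \<subseteq> D"
  shows "\<exists>Z\<in>U. ble Z X \<and> bspan Z \<subseteq> D"
  using pp assms unfolding pplus_filter_def is_full_def restr_def by blast

text \<open>Successive common lower bounds, starting from \<open>X\<close>, form a decreasing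
  sequence below the enumerated members; property \<open>(p)\<close> gives an almost lower bound of
  it.\<close>

lemma U_diagonal:
  assumes C: "countable \<Y>" "\<Y> \<subseteq> U" and X: "X \<in> U"
  shows "\<exists>Y\<in>U. ble Y X \<and> (\<forall>Z\<in>\<Y>. ble_star Y Z)"
proof (cases "\<Y> = {}")
  case True
  then show ?thesis using X ble_refl by blast
next
  case False
  define Ys where "Ys = from_nat_into \<Y>"
  have Ys: "Ys n \<in> U" for n
    using from_nat_into[OF False] C(2) by (auto simp: Ys_def)
  define Xs where "Xs = rec_nat X (\<lambda>n Z. SOME W. W \<in> U \<and> ble W Z \<and> ble W (Ys n))"
  have Suc: "Xs (Suc n) \<in> U \<and> ble (Xs (Suc n)) (Xs n) \<and> ble (Xs (Suc n)) (Ys n)"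
    if "Xs n \<in> U" for n
    using someI_ex[of "\<lambda>W. W \<in> U \<and> ble W (Xs n) \<and> ble W (Ys n)"] U_lower[OF that Ys[of n]]
    by (auto simp: Xs_def)
  have XsU: "Xs n \<in> U" for n
  proof (induction n)
    case 0
    then show ?case using X by (simp add: Xs_def)
  qed (use Suc in blast)
  then obtain Y where Y: "Y \<in> U" "\<And>n. ble_star Y (Xs n)"
    using pp Suc unfolding pplus_filter_def has_p_def by blast
  \<comment> \<open>Term 0 of the sequence is \<open>X\<close> itself, so a tail of \<open>Y\<close>
    is fully below \<open>X\<close>. The tail stays in \<open>U\<close> because \<open>Y\<close> is
    almost below it.\<close>
  obtain m where m: "ble (\<lambda>k. Y (k + m)) X"
    using Y(2)[of 0] by (auto simp: ble_star_def Xs_def)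
  define W where "W = (\<lambda>k. Y (k + m))"
  have W: "W \<in> Blocks" "ble_star W Y"
    unfolding W_def using tail_Blocks[OF U_Blocks[OF Y(1)]] ble_imp_star[OF ble_tail] by auto
  have "W \<in> U"
    using U_upward[OF Y(1) W(1)] ble_star_tail[OF U_Blocks[OF Y(1)]] by (simp add: W_def)
  moreover have "ble_star W Z" if Z: "Z \<in> \<Y>" for Z
  proof -
    obtain n where "Z = Ys n"
      using from_nat_into_surj[OF C(1) Z] by (auto simp: Ys_def)
    then show ?thesis
      using ble_star_trans[OF W(1) U_Blocks[OF Y(1)] W(2)]
        ble_star_trans[OF U_Blocks[OF Y(1)] U_Blocks[OF XsU] Y(2)] ble_imp_star Suc[OF XsU]
      by blast
  qed
  ultimately show ?thesis using m by (auto simp: W_def)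
qed

text \<open>The requirements are enumerated, and requirement \<open>e n\<close> is met on every tree
  of level \<open>n + 1\<close> of a fusion scheme. The filter members that witness this are
  countably many, so \<open>U_diagonal\<close> replaces them by one \<open>Y\<close>; monotonicity
  under almost inclusion keeps every requirement true. The tree part is uniform only level by level,
  hence the cones in the conclusion.\<close>

lemma fusion:
  assumes p: "perfect_tree p" and X: "X \<in> U" and I: "countable I"
    and mono: "\<And>i q q' Y Y'. \<lbrakk>i \<in> I; \<Phi> i q Y; perfect_tree q'; q' \<subseteq> q; Y \<in> U; Y' \<in> U; ble_star Y' Y\<rbrakk>
      \<Longrightarrow> \<Phi> i q' Y'"
    and dense: "\<And>i q. \<lbrakk>i \<in> I; perfect_tree q; q \<subseteq> p\<rbrakk>
      \<Longrightarrow> \<exists>q' Y. perfect_tree q' \<and> q' \<subseteq> q \<and> Y \<in> U \<and> \<Phi> i q' Y"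
  obtains q Y where "perfect_tree q" "q \<subseteq> p" "Y \<in> U" "ble Y X"
    "\<And>i. i \<in> I \<Longrightarrow> \<exists>N. \<forall>t\<in>q. length t = N \<longrightarrow> \<Phi> i (tcone q t) Y"
proof (cases "I = {}")
  case True
  then show thesis using that[OF p subset_refl X ble_refl] by blast
next
  case False
  define e where "e = from_nat_into I"
  have e: "e n \<in> I" for n using from_nat_into[OF False] by (simp add: e_def)
  define nxt where "nxt r b n = (SOME ry. perfect_tree (fst ry) \<and> fst ry \<subseteq> tcone r (split_node r b) \<and>
    snd ry \<in> U \<and> \<Phi> (e n) (fst ry) (snd ry))" for r b n
  have nxt: "perfect_tree (fst (nxt r b n)) \<and> fst (nxt r b n) \<subseteq> tcone r (split_node r b) \<and>
    snd (nxt r b n) \<in> U \<and> \<Phi> (e n) (fst (nxt r b n)) (snd (nxt r b n))"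
    if r: "perfect_tree r" "r \<subseteq> p" for r b n
  proof -
    have "perfect_tree (tcone r (split_node r b))" "tcone r (split_node r b) \<subseteq> p"
      using perfect_tree_tcone[OF r(1) split_node(1)[OF r(1)]] tcone_subset r(2) by blast+
    from dense[OF e this, of n]
    have "\<exists>ry. perfect_tree (fst ry) \<and> fst ry \<subseteq> tcone r (split_node r b) \<and>
      snd ry \<in> U \<and> \<Phi> (e n) (fst ry) (snd ry)" by simp
    from someI_ex[OF this] show ?thesis unfolding nxt_def .
  qed
  \<comment> \<open>The recursion carries a tree together with a filter member; the length of the
    bit list tells which requirement is next.\<close>
  define RY where "RY = rec_list (p, X) (\<lambda>b s ry. nxt (fst ry) b (length s))"
  define R where "R s = fst (RY s)" for s
  have RCons: "RY (b # s) = nxt (R s) b (length s)" for b s by (simp add: RY_def R_def)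
  have R: "perfect_tree (R s) \<and> R s \<subseteq> p" for s
  proof (induction s)
    case Nil
    then show ?case using p by (simp add: R_def RY_def)
  next
    case (Cons b s)
    then have "perfect_tree (R (b # s)) \<and> R (b # s) \<subseteq> tcone (R s) (split_node (R s) b)"
      using nxt[of "R s" b "length s"] RCons[of b s] unfolding R_def by simp
    then show ?case using Cons tcone_subset by blast
  qed
  have Cons: "R (b # s) \<subseteq> tcone (R s) (split_node (R s) b)" "snd (RY (b # s)) \<in> U"
    "\<Phi> (e (length s)) (R (b # s)) (snd (RY (b # s)))" for b s
    using nxt[of "R s" b "length s"] RCons[of b s] R unfolding R_def by simp_all
  have RYU: "range (\<lambda>s. snd (RY s)) \<subseteq> U"
  proof
    fix Y assume "Y \<in> range (\<lambda>s. snd (RY s))"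
    then obtain s where "Y = snd (RY s)" by blast
    then show "Y \<in> U" using Cons(2) X by (cases s) (auto simp: RY_def)
  qed
  obtain Y where Y: "Y \<in> U" "ble Y X" "\<And>s. ble_star Y (snd (RY s))"
    using U_diagonal[OF _ RYU X] by auto
  obtain q where q: "perfect_tree q" "q \<subseteq> R []"
    "\<And>n. \<exists>N. \<forall>t\<in>q. length t = N \<longrightarrow> (\<exists>s. length s = n \<and> tcone q t \<subseteq> R s)"
    using fusion_scheme[of R] R Cons(1) by blast
  have "\<exists>N. \<forall>t\<in>q. length t = N \<longrightarrow> \<Phi> i (tcone q t) Y" if i: "i \<in> I" for i
  proof -
    obtain n where n: "i = e n" using from_nat_into_surj[OF I i] by (auto simp: e_def)
    obtain N where N: "\<forall>t\<in>q. length t = N \<longrightarrow> (\<exists>s. length s = Suc n \<and> tcone q t \<subseteq> R s)"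
      using q(3) by blast
    have "\<Phi> i (tcone q t) Y" if t: "t \<in> q" "length t = N" for t
    proof -
      obtain s where s: "length s = Suc n" "tcone q t \<subseteq> R s" using N t by blast
      then obtain b s' where bs: "s = b # s'" "length s' = n" by (cases s) auto
      show ?thesis
        using mono[OF i _ perfect_tree_tcone[OF q(1) t(1)] s(2) _ Y(1) Y(3)[of s]] Cons(2)[of b s'] Cons(3)[of s' b] bs n
        by simp
    qed
    then show ?thesis by blast
  qed
  then show thesis using that[OF q(1) _ Y(1,2)] q(2) R by blast
qed

text \<open>Strategicity concerns strategies of II in \<open>G\<close>. Here II answers each block
  sequence by a vector of its span lying beyond the bound that \<sigma> assigns to the past moves.
  An outcome in \<open>U\<close> is then a play of \<open>F\<close> against \<sigma>.\<close>

lemma strategic_F: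
  assumes X: "X \<in> U"
  shows "\<exists>Z\<in>U. ble Z X \<and> (\<forall>k. \<sigma> (ini Z k) < Min (supp (Z k)))"
proof -
  \<comment> \<open>Past moves are stored newest first, so \<sigma> receives their reversal; the
    second term makes the answers a block sequence.\<close>
  define bd where "bd ys = max (\<sigma> (rev ys)) (if ys = [] then 0 else Max (supp (hd ys)))" for ys :: "'f vec list"
  define pick where "pick Z ys = (SOME y. y \<in> bspan Z \<and> supp y \<noteq> {} \<and> bd ys < Min (supp y))"
    for Z :: "'f bseq" and ys
  have pick: "pick Z ys \<in> bspan Z \<and> supp (pick Z ys) \<noteq> {} \<and> bd ys < Min (supp (pick Z ys))"
    if "Z \<in> Blocks" for Z ys
    using someI_ex[of "\<lambda>y. y \<in> bspan Z \<and> supp y \<noteq> {} \<and> bd ys < Min (supp y)"]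
      block_far_vector[OF that, of "bd ys"] unfolding pick_def by blast
  define hist where "hist = rec_list [] (\<lambda>Z Zs ys. pick Z ys # ys)"
  define \<alpha> where "\<alpha> Zs = hd (hist (rev Zs))" for Zs
  have hist: "hist (rev (ini Ys k)) = rev (ini (II_moves \<alpha> Ys) k)" for Ys k
  proof (induction k)
    case (Suc k)
    have "hist (rev (ini Ys (Suc k))) = pick (Ys k) (hist (rev (ini Ys k))) # hist (rev (ini Ys k))"
      by (simp add: hist_def)
    moreover from this have "II_moves \<alpha> Ys k = pick (Ys k) (hist (rev (ini Ys k)))"
      by (simp add: II_moves_def \<alpha>_def)
    ultimately show ?case using Suc by simp
  qed (simp add: hist_def)
  have mv: "II_moves \<alpha> Ys k = pick (Ys k) (rev (ini (II_moves \<alpha> Ys) k))" for Ys k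
    unfolding hist[symmetric] by (simp add: II_moves_def \<alpha>_def hist_def)
  have props: "II_moves \<alpha> Ys k \<in> bspan (Ys k)" "supp (II_moves \<alpha> Ys k) \<noteq> {}"
    "\<sigma> (ini (II_moves \<alpha> Ys) k) < Min (supp (II_moves \<alpha> Ys k))"
    "Max (supp (II_moves \<alpha> Ys k)) < Min (supp (II_moves \<alpha> Ys (Suc k)))"
    if Ys: "Ys \<in> I_plays_G X" for Ys k
  proof -
    have B: "Ys k \<in> Blocks" for k using Ys by (auto simp: I_plays_G_def)
    have P: "II_moves \<alpha> Ys k \<in> bspan (Ys k) \<and> supp (II_moves \<alpha> Ys k) \<noteq> {} \<and>
      bd (rev (ini (II_moves \<alpha> Ys) k)) < Min (supp (II_moves \<alpha> Ys k))" for k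
      using pick[OF B, of k "rev (ini (II_moves \<alpha> Ys) k)"] unfolding mv[symmetric] .
    show "II_moves \<alpha> Ys k \<in> bspan (Ys k)" "supp (II_moves \<alpha> Ys k) \<noteq> {}"
      "\<sigma> (ini (II_moves \<alpha> Ys) k) < Min (supp (II_moves \<alpha> Ys k))"
      using P[of k] by (auto simp: bd_def)
    show "Max (supp (II_moves \<alpha> Ys k)) < Min (supp (II_moves \<alpha> Ys (Suc k)))"
      using P[of "Suc k"] by (auto simp: bd_def)
  qed
  have "II_strategy_G [] X \<alpha>"
    unfolding II_strategy_G_def using props by (auto simp: above_def)
  then obtain Ys where Ys: "Ys \<in> I_plays_G X" "app [] (II_moves \<alpha> Ys) \<in> U"
    using strat X unfolding strategic_def outcomes_G_def by blast
  have "app [] (II_moves \<alpha> Ys) = II_moves \<alpha> Ys" by (simp add: app_def)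
  moreover have "ble (II_moves \<alpha> Ys) X"
    unfolding ble_def bspan_def
  proof (rule span_of_minimal)
    show "range (II_moves \<alpha> Ys) \<subseteq> span_of (range X)"
      using props(1)[OF Ys(1)] Ys(1) by (auto simp: I_plays_G_def ble_def bspan_def)
  qed
  ultimately show ?thesis using Ys props(3) by (metis (no_types, lifting))
qed

text \<open>Forcing form of ``every member of the filter has a block subsequence whose
  span, together with \<open>ys\<close>, lies in the generic set \<open>D f\<close>''.\<close>
definition good :: "((nat \<Rightarrow> bool) \<Rightarrow> 'f vec set) \<Rightarrow> bool list set \<Rightarrow> 'f vec set \<Rightarrow> bool" where
  "good D q ys \<longleftrightarrow> (\<forall>f\<in>branches q. span_of ys \<subseteq> D f) \<and>
    (\<forall>q' Y. perfect_tree q' \<longrightarrow> q' \<subseteq> q \<longrightarrow> Y \<in> U \<longrightarrow>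
      (\<exists>f\<in>branches q'. \<exists>Z\<in>Blocks. ble Z Y \<and> span_of (ys \<union> range Z) \<subseteq> D f))"

lemma good_mono: "good D q ys \<Longrightarrow> q' \<subseteq> q \<Longrightarrow> good D q' ys"
  unfolding good_def using branches_mono by blast

text \<open>Fullness is applied to the set \<open>E\<close> of vectors that can be added to
  \<open>ys\<close> after shrinking the tree. Below a given \<open>Y\<close>, fusion makes every
  vector outside \<open>E\<close> useless: no block sequence below \<open>Y1\<close> completes
  \<open>ys\<close> together with it. Goodness of \<open>ys\<close> still yields a completion
  \<open>Z\<close>, and the span of \<open>Z\<close> must then avoid all useless vectors, that is,
  lie in \<open>E\<close>.\<close>

lemma good_step:
  assumes op: "\<And>y f. f \<in> branches q \<Longrightarrow> y \<notin> D f \<Longrightarrow> \<exists>n. \<forall>g\<in>branches (tcone q (ini f n)). y \<notin> D g"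
    and q: "perfect_tree q" and good: "good D q ys"
  shows "\<exists>Y\<in>U. \<forall>y\<in>bspan Y. supp y \<noteq> {} \<longrightarrow> (\<exists>q'. perfect_tree q' \<and> q' \<subseteq> q \<and> good D q' (insert y ys))"
proof -
  define E where "E = {y \<in> Evec. supp y \<noteq> {} \<longrightarrow> (\<exists>q'. perfect_tree q' \<and> q' \<subseteq> q \<and> good D q' (insert y ys))}"
  define \<Phi> where "\<Phi> y q Y \<longleftrightarrow> (\<forall>f\<in>branches q. \<forall>Z\<in>Blocks. ble Z Y \<longrightarrow> \<not> span_of (insert y ys \<union> range Z) \<subseteq> D f)"
    for y q Y
  obtain X where X: "X \<in> U" using U_nonempty by blast
  have "\<exists>Z\<in>U. ble Z X \<and> bspan Z \<subseteq> E"
  proof (rule U_full[OF _ X])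
    show "E \<subseteq> Evec" by (auto simp: E_def)
    fix Y assume Y: "Y \<in> U" "ble Y X"
    obtain q1 Y1 where q1: "perfect_tree q1" "q1 \<subseteq> q" "Y1 \<in> U" "ble Y1 Y"
      and lev: "\<And>y. y \<in> Evec - E \<Longrightarrow> \<exists>N. \<forall>t\<in>q1. length t = N \<longrightarrow> \<Phi> y (tcone q1 t) Y1"
    proof (rule fusion[OF q Y(1), of "Evec - E" \<Phi>])
      show "countable (Evec - E)" using countable_Evec by (rule countable_subset[rotated]) auto
    next
      fix y q Y q' Y'
      assume A: "\<Phi> y q Y" "q' \<subseteq> q" "Y \<in> U" "Y' \<in> U" "ble_star Y' Y"
      show "\<Phi> y q' Y'"
        unfolding \<Phi>_def
      proof (intro ballI impI notI)
        fix f Z assume f: "f \<in> branches q'" and Z: "Z \<in> Blocks" "ble Z Y'"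
          and sub: "span_of (insert y ys \<union> range Z) \<subseteq> D f"
        obtain n where n: "(\<lambda>k. Z (k + n)) \<in> Blocks" "ble (\<lambda>k. Z (k + n)) Y"
          using ble_star_restrict[OF A(5) Z(1) U_Blocks[OF A(4)] Z(2)] .
        have "span_of (insert y ys \<union> range (\<lambda>k. Z (k + n))) \<subseteq> D f"
          using sub span_of_mono[of "insert y ys \<union> range (\<lambda>k. Z (k + n))" "insert y ys \<union> range Z"]
          by blast
        then show False using A(1) n f branches_mono[OF A(2)] unfolding \<Phi>_def by blast
      qed
    next
      fix y q1 assume y: "y \<in> Evec - E" and q1: "perfect_tree q1" "q1 \<subseteq> q"
      then have "\<not> good D q1 (insert y ys)" by (auto simp: E_def)
      \<comment> \<open>Goodness fails in one of two ways: a vector already spanned lies outside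
        \<open>D f\<close>, which by openness persists on a cone, or the completion clause fails for
        some tree and filter member, which is the requirement itself.\<close>
      then consider f v where "f \<in> branches q1" "v \<in> span_of (insert y ys)" "v \<notin> D f"
        | q' Y' where "perfect_tree q'" "q' \<subseteq> q1" "Y' \<in> U" "\<Phi> y q' Y'"
        unfolding good_def \<Phi>_def by blast
      then show "\<exists>q' Y. perfect_tree q' \<and> q' \<subseteq> q1 \<and> Y \<in> U \<and> \<Phi> y q' Y"
      proof cases
        case 1
        then obtain n where n: "\<forall>g\<in>branches (tcone q (ini f n)). v \<notin> D g"
          using op branches_mono[OF q1(2)] by blast
        have "\<Phi> y (tcone q1 (ini f n)) X"
          unfolding \<Phi>_def
        proof (intro ballI impI)
          fix g Z assume "g \<in> branches (tcone q1 (ini f n))"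
          then have "v \<notin> D g" using n branches_mono[OF tcone_mono[OF q1(2)]] by blast
          moreover have "v \<in> span_of (insert y ys \<union> range Z)"
            using 1(2) span_of_mono[of "insert y ys" "insert y ys \<union> range Z"] by blast
          ultimately show "\<not> span_of (insert y ys \<union> range Z) \<subseteq> D g" by blast
        qed
        then show ?thesis using perfect_tcone_ini[OF q1(1) 1(1)] tcone_subset X by blast
      qed blast
    qed blast
    obtain f Z where fZ: "f \<in> branches q1" "Z \<in> Blocks" "ble Z Y1" "span_of (ys \<union> range Z) \<subseteq> D f"
      using good q1 unfolding good_def by blast
    have "bspan Z \<subseteq> E"
    proof (rule ccontr)
      assume "\<not> bspan Z \<subseteq> E"
      then obtain y where y: "y \<in> bspan Z" "y \<notin> E" by blast
      then have "y \<in> Evec - E" using bspan_Evec[OF fZ(2)] by blast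
      then obtain N where "\<forall>t\<in>q1. length t = N \<longrightarrow> \<Phi> y (tcone q1 t) Y1" using lev by blast
      then have "\<Phi> y (tcone q1 (ini f N)) Y1" using ini_in_tree[OF fZ(1)] by simp
      then have "\<not> span_of (insert y ys \<union> range Z) \<subseteq> D f"
        using branches_tcone[OF fZ(1)] fZ unfolding \<Phi>_def by blast
      \<comment> \<open>Since \<open>y\<close> is in the span of \<open>Z\<close>, adding it to the
        generators changes nothing, so the completion \<open>Z\<close> of \<open>ys\<close> also
        completes \<open>insert y ys\<close>.\<close>
      moreover have "span_of (insert y ys \<union> range Z) \<subseteq> span_of (ys \<union> range Z)"
      proof (rule span_of_minimal)
        have "y \<in> span_of (ys \<union> range Z)"
          using y(1) span_of_mono[of "range Z" "ys \<union> range Z"] by (auto simp: bspan_def)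
        then show "insert y ys \<union> range Z \<subseteq> span_of (ys \<union> range Z)"
          using span_of_base[of _ "ys \<union> range Z"] by auto
      qed
      ultimately show False using fZ(4) by blast
    qed
    then show "\<exists>Z\<in>Blocks. ble Z Y \<and> bspan Z \<subseteq> E"
      using fZ(2) ble_trans[OF fZ(3) q1(4)] by blast
  qed
  then show ?thesis unfolding E_def by blast
qed

text \<open>If the second alternative holds for no pair below \<open>p\<close> and \<open>X\<close>,
  then the empty set is good on \<open>p\<close>. \<open>good_step\<close> is iterated along all
  finite lists of vectors and all bit lists; \<open>strategic_F\<close> picks from the resulting
  tree of choices one sequence in \<open>U\<close>, and the subtrees along it are fused.\<close>

lemma forced_fullness:
  assumes p: "perfect_tree p" and X: "X \<in> U"
    and zero: "\<And>f. (\<lambda>_. 0) \<in> D f"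
    and op: "\<And>y f. f \<in> branches p \<Longrightarrow> y \<notin> D f \<Longrightarrow> \<exists>n. \<forall>g\<in>branches (tcone p (ini f n)). y \<notin> D g"
  obtains q Y where "perfect_tree q" "q \<subseteq> p" "Y \<in> U" "ble Y X"
    "(\<forall>f\<in>branches q. bspan Y \<subseteq> D f) \<or>
     (\<forall>f\<in>branches q. \<forall>Z\<in>Blocks. ble Z Y \<longrightarrow> \<not> bspan Z \<subseteq> D f)"
proof (cases "\<exists>q Y. perfect_tree q \<and> q \<subseteq> p \<and> Y \<in> U \<and> ble Y X \<and>
    (\<forall>f\<in>branches q. \<forall>Z\<in>Blocks. ble Z Y \<longrightarrow> \<not> bspan Z \<subseteq> D f)")
  case True
  then show thesis using that by blast
next
  case False
  have "span_of {} = {\<lambda>_. 0 :: 'f}" by (auto simp: span_of_def)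
  then have good0: "good D p {}"
    unfolding good_def
  proof (intro conjI ballI allI impI)
    fix q' Y assume q': "perfect_tree q'" "q' \<subseteq> p" "Y \<in> U"
    obtain W where W: "W \<in> U" "ble W X" "ble W Y" using U_lower[OF X q'(3)] by blast
    then obtain f Z where "f \<in> branches q'" "Z \<in> Blocks" "ble Z W" "bspan Z \<subseteq> D f"
      using False q' by blast
    then show "\<exists>f\<in>branches q'. \<exists>Z\<in>Blocks. ble Z Y \<and> span_of ({} \<union> range Z) \<subseteq> D f"
      using ble_trans[OF _ W(3)] by (auto simp: bspan_def)
  qed (use zero in auto)
  define sub where "sub r b = tcone r (split_node r b)" for r b
  \<comment> \<open>\<open>P ys bs\<close> is the subtree at node \<open>bs\<close> of the scheme
    once the vectors \<open>ys\<close> are chosen, both lists newest first. It is meaningful only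
    when the choice succeeds, which \<open>valid\<close> records for the whole level.\<close>
  define P where "P = rec_list (\<lambda>_. p) (\<lambda>y ys P bs. SOME q'. perfect_tree q' \<and>
    q' \<subseteq> sub (P (tl bs)) (hd bs) \<and> good D q' (insert y (set ys)))"
  have PCons: "P (y # ys) (b # bs) = (SOME q'. perfect_tree q' \<and>
    q' \<subseteq> sub (P ys bs) b \<and> good D q' (insert y (set ys)))" for y ys b bs
    by (simp add: P_def)
  define valid where "valid ys \<longleftrightarrow> (\<forall>bs. length bs = length ys \<longrightarrow>
    perfect_tree (P ys bs) \<and> P ys bs \<subseteq> p \<and> good D (P ys bs) (set ys))" for ys
  define succ where "succ y ys \<longleftrightarrow> valid (y # ys) \<and>
    (\<forall>b bs. length bs = length ys \<longrightarrow> P (y # ys) (b # bs) \<subseteq> sub (P ys bs) b)" for y ys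
  define ok where "ok ys b bs Y \<longleftrightarrow> Y \<in> U \<and> (\<forall>y\<in>bspan Y. supp y \<noteq> {} \<longrightarrow>
    (\<exists>q'. perfect_tree q' \<and> q' \<subseteq> sub (P ys bs) b \<and> good D q' (insert y (set ys))))" for ys b bs Y
  have ex_ok: "\<exists>Y. ok ys b bs Y" if v: "valid ys" "length bs = length ys" for ys b bs
  proof -
    let ?q = "sub (P ys bs) b"
    have r: "perfect_tree (P ys bs)" "P ys bs \<subseteq> p" "good D (P ys bs) (set ys)"
      using v by (auto simp: valid_def)
    have qr: "?q \<subseteq> P ys bs" by (simp add: sub_def tcone_subset)
    then have qp: "?q \<subseteq> p" using r by blast
    have "\<exists>Y\<in>U. \<forall>y\<in>bspan Y. supp y \<noteq> {} \<longrightarrow> (\<exists>q'. perfect_tree q' \<and> q' \<subseteq> ?q \<and> good D q' (insert y (set ys)))"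
    proof (rule good_step)
      show "perfect_tree ?q" using perfect_tree_tcone[OF r(1) split_node(1)[OF r(1)]] by (simp add: sub_def)
      show "good D ?q (set ys)" using good_mono[OF r(3) qr] .
      fix y f assume "f \<in> branches ?q" "y \<notin> D f"
      then show "\<exists>n. \<forall>g\<in>branches (tcone ?q (ini f n)). y \<notin> D g"
        using op branches_mono[OF qp] branches_mono[OF tcone_mono[OF qp]] by blast
    qed
    then show ?thesis by (auto simp: ok_def)
  qed
  \<comment> \<open>The default \<open>X\<close> keeps every value in \<open>U\<close>, so that all
    values can be diagonalized together.\<close>
  define Yt where "Yt = (\<lambda>(ys, b, bs). if \<exists>Y. ok ys b bs Y then SOME Y. ok ys b bs Y else X)"
  have Yt_ok: "ok ys b bs (Yt (ys, b, bs))" if "valid ys" "length bs = length ys" for ys b bs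
    using ex_ok[OF that, of b] someI_ex[OF ex_ok[OF that, of b]] by (auto simp: Yt_def)
  have YtU: "Yt a \<in> U" for a
  proof (cases a)
    case (fields ys b bs)
    show ?thesis
    proof (cases "\<exists>Y. ok ys b bs Y")
      case True
      then have "Yt a = (SOME Y. ok ys b bs Y)" by (simp add: Yt_def fields)
      then have "ok ys b bs (Yt a)" using someI_ex[OF True] by simp
      then show ?thesis by (simp add: ok_def)
    qed (use X in \<open>auto simp: Yt_def fields\<close>)
  qed
  have "countable (Yt ` (lists Evec \<times> UNIV))"
    by (intro countable_image countable_SIGMA countable_lists countable_Evec countableI_type)
  then obtain Y where Y: "Y \<in> U" "ble Y X" "\<And>a. a \<in> lists Evec \<times> UNIV \<Longrightarrow> ble_star Y (Yt a)"
    using U_diagonal[of "Yt ` (lists Evec \<times> UNIV)" X] YtU X by blast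
  note YB = U_Blocks[OF Y(1)]
  \<comment> \<open>A new vector must be acceptable in all subtrees of the current level at once.
    There are finitely many of them, and a vector of \<open>Y\<close> beyond the largest of their
    thresholds lies in every relevant \<open>bspan (Yt (ys, b, bs))\<close>.\<close>
  have "\<exists>m. \<forall>y\<in>bspan Y. supp y \<noteq> {} \<longrightarrow> m < Min (supp y) \<longrightarrow> succ y ys"
    if v: "valid ys" "ys \<in> lists Evec" for ys
  proof -
    let ?S = "{(b, bs). length bs = length ys} :: (bool \<times> bool list) set"
    have "?S = UNIV \<times> {bs. set bs \<subseteq> UNIV \<and> length bs = length ys}" by auto
    moreover have "finite {bs. set bs \<subseteq> (UNIV :: bool set) \<and> length bs = length ys}"
      by (intro finite_lists_length_eq) simp
    ultimately have fin: "finite ?S" using finite_cartesian_product by fastforce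
    have "\<forall>a. \<exists>m. \<forall>y\<in>bspan Y. (\<forall>i\<le>m. y i = 0) \<longrightarrow> y \<in> bspan (Yt (ys, a))"
      using Y(3) v(2) ble_star_iff[OF YB] by blast
    then obtain m where m: "\<And>a y. y \<in> bspan Y \<Longrightarrow> (\<forall>i\<le>m a. y i = 0) \<Longrightarrow> y \<in> bspan (Yt (ys, a))"
      by metis
    have "succ y ys" if y: "y \<in> bspan Y" "supp y \<noteq> {}" "Max (m ` ?S) < Min (supp y)" for y
    proof -
      have step: "perfect_tree (P (y # ys) (b # bs)) \<and> P (y # ys) (b # bs) \<subseteq> sub (P ys bs) b \<and>
        good D (P (y # ys) (b # bs)) (set (y # ys))" if bs: "length bs = length ys" for b bs
      proof -
        have mb: "m (b, bs) \<le> Max (m ` ?S)"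
          using fin bs by (intro Max_ge) auto
        have "\<forall>i\<le>m (b, bs). y i = 0"
          using less_Min_supp_iff[of y "Max (m ` ?S)"] y bspan_Evec[OF YB] mb by auto
        then have "y \<in> bspan (Yt (ys, b, bs))" using m y(1) by blast
        then have "\<exists>q'. perfect_tree q' \<and> q' \<subseteq> sub (P ys bs) b \<and> good D q' (insert y (set ys))"
          using Yt_ok[OF v(1) bs] y(2) by (auto simp: ok_def)
        from someI_ex[OF this, folded PCons] show ?thesis by simp
      qed
      moreover have "sub (P ys bs) b \<subseteq> p" if "length bs = length ys" for b bs
        using v(1) that tcone_subset[of "P ys bs"] by (auto simp: valid_def sub_def)
      ultimately show ?thesis
        unfolding succ_def valid_def by (auto simp: length_Suc_conv) blast+
    qed
    then show ?thesis by blast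
  qed
  then obtain m where m: "\<And>ys y. valid ys \<Longrightarrow> ys \<in> lists Evec \<Longrightarrow> y \<in> bspan Y \<Longrightarrow> supp y \<noteq> {} \<Longrightarrow>
    m ys < Min (supp y) \<Longrightarrow> succ y ys" by metis
  obtain Z where Z: "Z \<in> U" "ble Z Y" "\<And>k. m (rev (ini Z k)) < Min (supp (Z k))"
    using strategic_F[OF Y(1), of "\<lambda>ys. m (rev ys)"] by blast
  note ZB = U_Blocks[OF Z(1)]
  have ZE: "Z k \<in> Evec" for k using ZB by (auto simp: Blocks_def is_block_def)
  have Zs: "succ (Z k) (rev (ini Z k))" if "valid (rev (ini Z k))" for k
  proof (rule m[OF that])
    show "rev (ini Z k) \<in> lists Evec" using ZE by auto
    show "Z k \<in> bspan Y" using block_in_bspan[of Z k] Z(2) by (auto simp: ble_def)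
  qed (use Z(3) block_fin[OF ZB] in auto)
  have val: "valid (rev (ini Z k))" for k
  proof (induction k)
    case 0
    then show ?case using p good0 by (simp add: valid_def P_def)
  next
    case (Suc k)
    then show ?case using Zs by (simp add: succ_def)
  qed
  define R where "R s = P (rev (ini Z (length s))) s" for s
  have R: "perfect_tree (R s)" "good D (R s) (set (ini Z (length s)))" for s
    using val[of "length s"] by (auto simp: valid_def R_def)
  have "R (b # s) \<subseteq> tcone (R s) (split_node (R s) b)" for b s
    using Zs[OF val, of "length s"] by (simp add: succ_def R_def sub_def)
  then obtain q where q: "perfect_tree q" "q \<subseteq> R []"
    "\<And>n. \<exists>N. \<forall>t\<in>q. length t = N \<longrightarrow> (\<exists>s. length s = n \<and> tcone q t \<subseteq> R s)"
    using fusion_scheme[of R] R by blast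
  \<comment> \<open>A vector of the span involves only the first \<open>n\<close> terms of
    \<open>Z\<close>, and \<open>f\<close> is a branch of some tree of level \<open>n\<close>; the
    first clause of \<open>good\<close> there puts the vector into \<open>D f\<close>.\<close>
  have "bspan Z \<subseteq> D f" if f: "f \<in> branches q" for f
  proof
    fix v assume "v \<in> bspan Z"
    then obtain T c where T: "finite T" "T \<subseteq> range Z" "v = (\<lambda>i. \<Sum>x\<in>T. c x * x i)"
      unfolding bspan_def span_of_def by blast
    obtain J where J: "finite J" "T = Z ` J" using finite_subset_image[OF T(1,2)] by blast
    then obtain n where "\<forall>j\<in>J. j < n" using finite_nat_set_iff_bounded by blast
    then have "T \<subseteq> set (ini Z n)" using J by auto
    then have v: "v \<in> span_of (set (ini Z n))" using T unfolding span_of_def by blast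
    obtain N where "\<forall>t\<in>q. length t = N \<longrightarrow> (\<exists>s. length s = n \<and> tcone q t \<subseteq> R s)" using q(3) by blast
    then obtain s where s: "length s = n" "tcone q (ini f N) \<subseteq> R s"
      using ini_in_tree[OF f, of N] by auto
    then have "f \<in> branches (R s)" using branches_tcone[OF f] branches_mono by blast
    then show "v \<in> D f" using R(2)[of s] v s(1) unfolding good_def by blast
  qed
  moreover have "R [] = p" by (simp add: R_def P_def)
  ultimately show thesis using that[OF q(1) _ Z(1) ble_trans[OF Z(2) Y(2)]] q(2) by blast
qed

end

section \<open>Positions with labels\<close>

lemma app_Blocks:
  assumes x: "x \<in> FBlocks" and y: "\<And>k. y k \<in> Evec" "\<And>k. supp (y k) \<noteq> {}"
    and ab: "above x (y 0)" and inc: "\<And>k. Max (supp (y k)) < Min (supp (y (Suc k)))"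
  shows "app x y \<in> Blocks"
  unfolding Blocks_def is_block_def mem_Collect_eq
proof (intro conjI allI)
  fix n
  show "app x y n \<in> Evec" "supp (app x y n) \<noteq> {}"
    using x y by (auto simp: app_def FBlocks_def is_fin_block_def)
next
  fix n
  consider "Suc n < length x" | "Suc n = length x" | "length x \<le> n" by linarith
  then show "Max (supp (app x y n)) < Min (supp (app x y (Suc n)))"
  proof cases
    case 1
    then show ?thesis using x by (auto simp: app_def FBlocks_def is_fin_block_def)
  next
    case 2
    then have "last x = x ! n" by (metis diff_Suc_1 last_conv_nth list.size(3) nat.distinct(1))
    then show ?thesis using 2 ab by (auto simp: app_def above_def)
  next
    case 3
    then show ?thesis using inc[of "n - length x"] by (simp add: app_def Suc_diff_le)
  qed
qed

lemma ini_app: "ini (app x y) (length x) = x"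
  by (auto simp: app_def intro!: nth_equalityI)

lemma app_shift: "app (x @ ini y i) (\<lambda>k. y (k + i)) = app x y"
  by (auto simp: app_def nth_append)

lemma outcomes_F_Blocks:
  assumes "x \<in> FBlocks" "Y \<in> Blocks"
  shows "outcomes_F x Y \<sigma> \<subseteq> Blocks"
  using app_Blocks[OF assms(1)] bspan_Evec[OF assms(2)] unfolding outcomes_F_def by blast

text \<open>I adds to \<sigma> the threshold beyond which vectors of \<open>Y'\<close> belong to the
  span of \<open>Y\<close>.\<close>

lemma outcomes_F_weaken:
  fixes Y :: "('f::field) bseq"
  assumes "ble_star Y' Y" "Y' \<in> Blocks"
  shows "\<exists>\<sigma>'. outcomes_F x Y' \<sigma>' \<subseteq> outcomes_F x Y \<sigma>"
proof -
  obtain m where m: "\<forall>v\<in>bspan Y'. (\<forall>i\<le>m. v i = 0) \<longrightarrow> v \<in> bspan Y"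
    using assms ble_star_iff by blast
  have "v \<in> bspan Y" if "v \<in> bspan Y'" "supp v \<noteq> {}" "m < Min (supp v)" for v
    using m that less_Min_supp_iff[of v m] bspan_Evec[OF assms(2)] by blast
  then have "outcomes_F x Y' (\<lambda>ys. max m (\<sigma> ys)) \<subseteq> outcomes_F x Y \<sigma>"
    unfolding outcomes_F_def by (auto simp del: map_map)
  then show ?thesis by blast
qed

lemma outcomes_F_mono: "(\<And>ys. \<sigma> ys \<le> \<sigma>' ys) \<Longrightarrow> outcomes_F x Y \<sigma>' \<subseteq> outcomes_F x Y \<sigma>"
  unfolding outcomes_F_def by (auto intro: le_less_trans)

text \<open>The analytic set under consideration is the projection of \<open>{(b, f, Z). C b f Z}\<close>
  along \<open>b\<close>; the label \<open>s\<close> restricts the witness \<open>b\<close> to extensions of \<open>s\<close>.\<close>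
definition has_witness :: "((nat \<Rightarrow> nat) \<Rightarrow> (nat \<Rightarrow> bool) \<Rightarrow> 'b \<Rightarrow> bool) \<Rightarrow> nat list \<Rightarrow> (nat \<Rightarrow> bool) \<Rightarrow> 'b \<Rightarrow> bool" where
  "has_witness C s f z \<longleftrightarrow> (\<exists>b. ini b (length s) = s \<and> C b f z)"

text \<open>One strategy of I has to serve all branches of \<open>q\<close>, as in alternative (i)
  of the Ramsey property.\<close>

definition avoidable :: "((nat \<Rightarrow> nat) \<Rightarrow> (nat \<Rightarrow> bool) \<Rightarrow> ('f::comm_ring_1) bseq \<Rightarrow> bool) \<Rightarrow>
    bool list set \<Rightarrow> 'f bseq \<Rightarrow> 'f vec list \<Rightarrow> nat list \<Rightarrow> bool" where
  "avoidable C q Y x s \<longleftrightarrow> (\<exists>\<sigma>. \<forall>f\<in>branches q. \<forall>z\<in>outcomes_F x Y \<sigma>. \<not> has_witness C s f z)"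

lemma avoidable_mono:
  fixes Y :: "('f::field) bseq"
  assumes "avoidable C q Y x s" "q' \<subseteq> q" "ble_star Y' Y" "Y' \<in> Blocks"
  shows "avoidable C q' Y' x s"
  using assms(1) outcomes_F_weaken[OF assms(3,4), of x] branches_mono[OF assms(2)]
  unfolding avoidable_def by blast

lemma finite_level: "finite {t \<in> q. length t = (N::nat)}" for q :: "bool list set"
proof -
  have "finite {t. set t \<subseteq> (UNIV :: bool set) \<and> length t = N}" by (intro finite_lists_length_eq) simp
  then show ?thesis by (rule finite_subset[rotated]) auto
qed

text \<open>A level has finitely many nodes, and I plays the maximum of their strategies: larger
  numbers only restrict II further.\<close>

lemma avoidable_cones:
  assumes "\<And>t. t \<in> q \<Longrightarrow> length t = N \<Longrightarrow> avoidable C (tcone q t) Y x s"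
  shows "avoidable C q Y x s"
proof -
  let ?S = "{t \<in> q. length t = N}"
  have "\<forall>t\<in>?S. \<exists>\<sigma>. \<forall>f\<in>branches (tcone q t). \<forall>z\<in>outcomes_F x Y \<sigma>. \<not> has_witness C s f z"
    using assms by (auto simp: avoidable_def)
  then obtain \<sigma> where \<sigma>: "\<forall>t\<in>?S. \<forall>f\<in>branches (tcone q t). \<forall>z\<in>outcomes_F x Y (\<sigma> t). \<not> has_witness C s f z"
    by metis
  define \<tau> where "\<tau> ys = Max ((\<lambda>t. \<sigma> t ys) ` ?S)" for ys
  show ?thesis
    unfolding avoidable_def
  proof (intro exI[of _ \<tau>] ballI)
    fix f z assume f: "f \<in> branches q" and z: "z \<in> outcomes_F x Y \<tau>"
    have S: "ini f N \<in> ?S" using ini_in_tree[OF f] by simp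
    have "\<sigma> (ini f N) ys \<le> \<tau> ys" for ys
      unfolding \<tau>_def using S by (intro Max_ge finite_imageI finite_level) blast
    then have "z \<in> outcomes_F x Y (\<sigma> (ini f N))" using outcomes_F_mono z by blast
    then show "\<not> has_witness C s f z" using \<sigma> S branches_tcone[OF f] by blast
  qed
qed

text \<open>II can force the game \<open>G\<close> from \<open>x\<close> into \<open>P\<close> after
  finitely many, and at least one, moves. The inductive definition supplies the well-foundedness:
  against each move of I the remaining play has a smaller derivation.\<close>

inductive reach :: "('f vec list \<Rightarrow> bool) \<Rightarrow> ('f::comm_ring_1) bseq \<Rightarrow> 'f vec list \<Rightarrow> bool" for P Y where
  reachI: "(\<And>Z. Z \<in> Blocks \<Longrightarrow> ble Z Y \<Longrightarrow>
    \<exists>y\<in>bspan Z. supp y \<noteq> {} \<and> above x y \<and> (P (x @ [y]) \<or> reach P Y (x @ [y]))) \<Longrightarrow> reach P Y x"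

lemma reach_mono:
  fixes Y :: "('f::field) bseq"
  assumes "reach P Y x" "ble_star Y' Y" "Y' \<in> Blocks"
  shows "reach P Y' x"
  using assms(1)
proof (induction rule: reach.induct)
  case (reachI x)
  show ?case
  proof (rule reach.reachI)
    fix Z assume Z: "Z \<in> Blocks" "ble Z Y'"
    obtain n where n: "(\<lambda>k. Z (k + n)) \<in> Blocks" "ble (\<lambda>k. Z (k + n)) Y"
      using ble_star_restrict[OF assms(2) Z(1) assms(3) Z(2)] .
    show "\<exists>y\<in>bspan Z. supp y \<noteq> {} \<and> above x y \<and> (P (x @ [y]) \<or> reach P Y' (x @ [y]))"
      using reachI[OF n] ble_tail[of Z n] unfolding ble_def by blast
  qed
qed

lemma above_snoc: "above (x @ ini y (Suc k)) (y (Suc k)) \<longleftrightarrow> Max (supp (y k)) < Min (supp (y (Suc k)))"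
  by (simp add: above_def)

text \<open>The pair \<open>(r, W)\<close> comes from a fusion that settles every position and
  label: near each branch the labelled piece is either avoidable or remains so for no subtree and no
  filter member.\<close>

locale decided = strategic_pplus U for U :: "('f::{field,countable}) bseq set" +
  fixes C :: "(nat \<Rightarrow> nat) \<Rightarrow> (nat \<Rightarrow> bool) \<Rightarrow> 'f bseq \<Rightarrow> bool"
    and r :: "bool list set" and W :: "'f bseq"
  assumes r: "perfect_tree r" and W: "W \<in> U"
    and dec: "\<And>x s. x \<in> FBlocks \<Longrightarrow> \<exists>N. \<forall>t\<in>r. length t = N \<longrightarrow> avoidable C (tcone r t) W x s \<or>
      (\<forall>q Y. perfect_tree q \<longrightarrow> q \<subseteq> tcone r t \<longrightarrow> Y \<in> U \<longrightarrow> \<not> avoidable C q Y x s)"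
begin

text \<open>Unavoidability is read off the cones of the fixed tree \<open>r\<close> only: another perfect
  tree through \<open>f\<close> may have no branch but \<open>f\<close> in common with \<open>r\<close>.\<close>
definition unavoidable :: "(nat \<Rightarrow> bool) \<Rightarrow> 'f vec list \<Rightarrow> nat list \<Rightarrow> bool" where
  "unavoidable f x s \<longleftrightarrow> (\<forall>n. \<not> avoidable C (tcone r (ini f n)) W x s)"

text \<open>If the cone at the deciding level is not avoidable, no perfect subtree of it is, and
  hence no cone about \<open>f\<close> at all. On the branches of \<open>r\<close> unavoidability is
  thus determined by finitely many values of \<open>f\<close>; this provides the openness that
  \<open>forced_fullness\<close> asks for.\<close>

lemma unavoidable_level:
  assumes x: "x \<in> FBlocks"
  shows "\<exists>N. \<forall>f\<in>branches r. (unavoidable f x s \<longleftrightarrow> \<not> avoidable C (tcone r (ini f N)) W x s) \<and>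
    (unavoidable f x s \<longrightarrow> (\<forall>q Y. perfect_tree q \<longrightarrow> q \<subseteq> tcone r (ini f N) \<longrightarrow> Y \<in> U \<longrightarrow> \<not> avoidable C q Y x s))"
proof -
  obtain N where N: "\<And>t. t \<in> r \<Longrightarrow> length t = N \<Longrightarrow> avoidable C (tcone r t) W x s \<or>
      (\<forall>q Y. perfect_tree q \<longrightarrow> q \<subseteq> tcone r t \<longrightarrow> Y \<in> U \<longrightarrow> \<not> avoidable C q Y x s)"
    using dec[OF x] by blast
  have *: "unavoidable f x s" "\<forall>q Y. perfect_tree q \<longrightarrow> q \<subseteq> tcone r (ini f N) \<longrightarrow> Y \<in> U \<longrightarrow> \<not> avoidable C q Y x s"
    if f: "f \<in> branches r" and nI: "\<not> avoidable C (tcone r (ini f N)) W x s" for f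
  proof -
    show no: "\<forall>q Y. perfect_tree q \<longrightarrow> q \<subseteq> tcone r (ini f N) \<longrightarrow> Y \<in> U \<longrightarrow> \<not> avoidable C q Y x s"
      using N[OF ini_in_tree[OF f, of N]] nI by simp
    show "unavoidable f x s"
      unfolding unavoidable_def
    proof (intro allI notI)
      fix n assume I: "avoidable C (tcone r (ini f n)) W x s"
      have "tcone r (ini f (max n N)) \<subseteq> tcone r (ini f n)" "tcone r (ini f (max n N)) \<subseteq> tcone r (ini f N)"
        by (simp_all add: tcone_ini_antimono)
      then show False
        using no perfect_tcone_ini[OF r f] W avoidable_mono[OF I _ ble_imp_star[OF ble_refl] U_Blocks[OF W]] by blast
    qed
  qed
  show ?thesis
    using * unavoidable_def by blast
qed

text \<open>Each cone of \<open>q\<close> at the deciding level contains a branch, which shows that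
  cone to be avoidable; finitely many cones are then glued.\<close>

lemma not_unavoidable:
  assumes q: "perfect_tree q" "q \<subseteq> r" and Y: "Y \<in> U" "ble_star Y W" and x: "x \<in> FBlocks"
    and nV: "\<And>f. f \<in> branches q \<Longrightarrow> \<not> unavoidable f x s"
  shows "avoidable C q Y x s"
proof -
  obtain N where N: "\<And>f. f \<in> branches r \<Longrightarrow> unavoidable f x s \<longleftrightarrow> \<not> avoidable C (tcone r (ini f N)) W x s"
    using unavoidable_level[OF x] by blast
  show ?thesis
  proof (rule avoidable_cones[where N = N])
    fix t assume t: "t \<in> q" "length t = N"
    obtain f where f: "f \<in> branches (tcone q t)"
      using branches_nonempty[OF perfect_tree_tcone[OF q(1) t(1)]] by blast
    note fq = branches_tconeD[OF f]
    have "avoidable C (tcone r t) W x s" using N[of f] nV fq t(2) branches_mono[OF q(2)] by auto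
    then show "avoidable C (tcone q t) Y x s"
      using avoidable_mono tcone_mono[OF q(2)] Y U_Blocks by blast
  qed
qed

section \<open>Reaching unavoidable positions, and the forcing negation of this\<close>

definition reachable :: "(nat \<Rightarrow> bool) \<Rightarrow> 'f bseq \<Rightarrow> 'f vec list \<Rightarrow> nat list \<Rightarrow> bool" where
  "reachable f Y x s \<longleftrightarrow> reach (\<lambda>x. \<exists>n. unavoidable f x (s @ [n])) Y x"

lemma reachable_mono: "reachable f Y x s \<Longrightarrow> ble_star Y' Y \<Longrightarrow> Y' \<in> U \<Longrightarrow> reachable f Y' x s"
  unfolding reachable_def using reach_mono U_Blocks by blast

text \<open>The forcing negation of \<open>reachable\<close>: no perfect subtree with a filter
  member makes it true along all branches. Hence every tree either has this property or contains a
  subtree on which \<open>x\<close> is reachable.\<close>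

definition never_reached :: "bool list set \<Rightarrow> 'f vec list \<Rightarrow> nat list \<Rightarrow> bool" where
  "never_reached p x s \<longleftrightarrow> (\<forall>q Y. perfect_tree q \<longrightarrow> q \<subseteq> p \<longrightarrow> Y \<in> U \<longrightarrow> \<not> (\<forall>f\<in>branches q. reachable f Y x s))"

lemma never_reached_mono: "never_reached p x s \<Longrightarrow> q \<subseteq> p \<Longrightarrow> never_reached q x s"
  unfolding never_reached_def by blast

text \<open>\<open>never_reached\<close> is asked only on some cone about each branch, because
  fusion decides it at a level depending on the position.\<close>

definition stay :: "bool list set \<Rightarrow> 'f vec list \<Rightarrow> nat list \<Rightarrow> bool" where
  "stay q x s \<longleftrightarrow> (\<forall>f\<in>branches q. (\<exists>n. never_reached (tcone q (ini f n)) x s) \<and> (\<forall>n. \<not> unavoidable f x (s @ [n])))"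

lemma stay_mono: "stay q x s \<Longrightarrow> q' \<subseteq> q \<Longrightarrow> stay q' x s"
  unfolding stay_def using branches_mono[of q' q] never_reached_mono[OF _ tcone_mono[of q' q]] by blast

text \<open>\<open>forced_fullness\<close> is applied to the safe vectors: those that lead neither
  to an unavoidable longer label nor to a position from which one can be reached. If no block
  sequence below \<open>Y\<close> has its span among them, II can answer every move of I by an
  unsafe vector, so \<open>x\<close> itself is reachable on a subtree, against
  \<open>never_reached\<close>.\<close>

lemma never_reached_step:
  assumes p: "perfect_tree p" "p \<subseteq> r" and x: "x \<in> FBlocks" and nr: "never_reached p x s"
  shows "\<exists>q Y. perfect_tree q \<and> q \<subseteq> p \<and> Y \<in> U \<and>
    (\<forall>y\<in>bspan Y. supp y \<noteq> {} \<longrightarrow> above x y \<longrightarrow> stay q (x @ [y]) s)"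
proof -
  define I where "I = {y \<in> Evec. supp y \<noteq> {} \<and> above x y}"
  have xy: "x @ [y] \<in> FBlocks" if "y \<in> I" for y
    using that FBlocks_snoc[OF x] by (auto simp: I_def)
  define \<Phi> where "\<Phi> y q Y \<longleftrightarrow> (\<forall>f\<in>branches q. reachable f Y (x @ [y]) s) \<or> never_reached q (x @ [y]) s" for y q Y
  obtain X where X: "X \<in> U" using U_nonempty by blast
  obtain q0 Y0 where q0: "perfect_tree q0" "q0 \<subseteq> p" "Y0 \<in> U" "ble Y0 X"
    and lev: "\<And>y. y \<in> I \<Longrightarrow> \<exists>N. \<forall>t\<in>q0. length t = N \<longrightarrow> \<Phi> y (tcone q0 t) Y0"
  proof (rule fusion[OF p(1) X, of I \<Phi>])
    show "countable I" using countable_Evec by (rule countable_subset[rotated]) (auto simp: I_def)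
    show "\<Phi> y q' Y'" if A: "\<Phi> y q Y" "q' \<subseteq> q" "Y' \<in> U" "ble_star Y' Y" for y q Y q' Y'
      using A(1) branches_mono[OF A(2)] reachable_mono[OF _ A(4,3)] never_reached_mono[OF _ A(2)] unfolding \<Phi>_def by blast
    show "\<exists>q' Y. perfect_tree q' \<and> q' \<subseteq> q \<and> Y \<in> U \<and> \<Phi> y q' Y" if "perfect_tree q" for y q
    proof (cases "never_reached q (x @ [y]) s")
      case True
      then show ?thesis using that X unfolding \<Phi>_def by blast
    qed (auto simp: never_reached_def \<Phi>_def)
  qed blast
  then obtain N where N: "\<And>y t. y \<in> I \<Longrightarrow> t \<in> q0 \<Longrightarrow> length t = N y \<Longrightarrow> \<Phi> y (tcone q0 t) Y0"
    by metis
  \<comment> \<open>Vectors that are not legal moves, zero included, are counted as safe; an unsafe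
    vector is therefore always a legal move.\<close>
  define D where "D f = {y. y \<in> I \<longrightarrow> never_reached (tcone q0 (ini f (N y))) (x @ [y]) s \<and>
    (\<forall>n. \<not> unavoidable f (x @ [y]) (s @ [n]))}" for f
  have q0r: "q0 \<subseteq> r" using q0 p by blast
  have zero: "(\<lambda>_. 0) \<in> D f" for f by (simp add: D_def I_def supp_def)
  \<comment> \<open>The first clause depends only on \<open>N y\<close> values of \<open>f\<close>,
    and a violation of the second persists on a cone by \<open>unavoidable_level\<close>.\<close>
  have op: "\<exists>n. \<forall>g\<in>branches (tcone q0 (ini f n)). y \<notin> D g" if f: "f \<in> branches q0" and y: "y \<notin> D f" for y f
  proof (cases "never_reached (tcone q0 (ini f (N y))) (x @ [y]) s")
    case False
    have "y \<notin> D g" if "g \<in> branches (tcone q0 (ini f (N y)))" for g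
    proof
      have "y \<in> I" using y by (auto simp: D_def)
      moreover assume "y \<in> D g"
      ultimately have "never_reached (tcone q0 (ini g (N y))) (x @ [y]) s" by (simp add: D_def)
      moreover have "ini g (N y) = ini f (N y)" using branches_tconeD(2)[OF that] by simp
      ultimately show False using False by metis
    qed
    then show ?thesis by blast
  next
    case True
    then obtain n where n: "y \<in> I" "unavoidable f (x @ [y]) (s @ [n])" using y by (auto simp: D_def)
    obtain M where M: "\<And>f. f \<in> branches r \<Longrightarrow> unavoidable f (x @ [y]) (s @ [n]) \<longleftrightarrow> \<not> avoidable C (tcone r (ini f M)) W (x @ [y]) (s @ [n])"
      using unavoidable_level[OF xy[OF n(1)]] by blast
    have "y \<notin> D g" if g: "g \<in> branches (tcone q0 (ini f M))" for g
    proof -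
      have "ini g M = ini f M" "g \<in> branches r"
        using branches_tconeD[OF g] branches_mono[OF q0r] by auto
      then have "unavoidable g (x @ [y]) (s @ [n])"
        using M n(2) f branches_mono[OF q0r] by (metis subsetD)
      then show ?thesis using n(1) by (auto simp: D_def)
    qed
    then show ?thesis by blast
  qed
  obtain q Y where q: "perfect_tree q" "q \<subseteq> q0" "Y \<in> U" "ble Y Y0"
    and alt: "(\<forall>f\<in>branches q. bspan Y \<subseteq> D f) \<or>
     (\<forall>f\<in>branches q. \<forall>Z\<in>Blocks. ble Z Y \<longrightarrow> \<not> bspan Z \<subseteq> D f)"
    using forced_fullness[of q0 Y0 D, OF q0(1,3) zero op] by blast
  from alt show ?thesis
  proof
    assume A: "\<forall>f\<in>branches q. bspan Y \<subseteq> D f"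
    have "stay q (x @ [y]) s" if y: "y \<in> bspan Y" "supp y \<noteq> {}" "above x y" for y
      unfolding stay_def
    proof
      fix f assume f: "f \<in> branches q"
      have "y \<in> I" using y bspan_Evec[OF U_Blocks[OF q(3)]] by (auto simp: I_def)
      then have "never_reached (tcone q0 (ini f (N y))) (x @ [y]) s" "\<forall>n. \<not> unavoidable f (x @ [y]) (s @ [n])"
        using A f y(1) by (auto simp: D_def)
      then show "(\<exists>n. never_reached (tcone q (ini f n)) (x @ [y]) s) \<and> (\<forall>n. \<not> unavoidable f (x @ [y]) (s @ [n]))"
        using never_reached_mono[OF _ tcone_mono[OF q(2)]] by blast
    qed
    then show ?thesis using q q0(2) by blast
  next
    assume A: "\<forall>f\<in>branches q. \<forall>Z\<in>Blocks. ble Z Y \<longrightarrow> \<not> bspan Z \<subseteq> D f"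
    have "reachable f Y x s" if f: "f \<in> branches q" for f
      unfolding reachable_def
    proof (rule reachI, fold reachable_def)
      fix Z assume Z: "Z \<in> Blocks" "ble Z Y"
      then obtain y where y: "y \<in> bspan Z" "y \<notin> D f" using A f by blast
      then have yI: "y \<in> I" by (auto simp: D_def)
      have f0: "f \<in> branches q0" using f branches_mono[OF q(2)] by blast
      have "(\<exists>n. unavoidable f (x @ [y]) (s @ [n])) \<or> reachable f Y (x @ [y]) s"
      proof (cases "never_reached (tcone q0 (ini f (N y))) (x @ [y]) s")
        case True
        then show ?thesis using y(2) by (auto simp: D_def)
      next
        case False
        then have "reachable f Y0 (x @ [y]) s"
          using N[OF yI ini_in_tree[OF f0, of "N y"]] branches_tcone[OF f0] by (auto simp: \<Phi>_def)
        then show ?thesis using reachable_mono[OF _ ble_imp_star[OF q(4)] q(3)] by blast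
      qed
      then show "\<exists>y\<in>bspan Z. supp y \<noteq> {} \<and> above x y \<and>
          ((\<exists>n. unavoidable f (x @ [y]) (s @ [n])) \<or> reachable f Y (x @ [y]) s)"
        using y(1) yI by (auto simp: I_def)
    qed
    then show ?thesis using nr q q0(2) unfolding never_reached_def by blast
  qed
qed

text \<open>I follows a strategy that never leaves the positions from which II cannot force an unavoidable
  one; at time \<open>i\<close> he starts to avoid, for the labels \<open>s @ [n]\<close> with \<open>n < i\<close>, the corresponding
  pieces of the analytic set.\<close>
lemma never_reached_imp_avoidable:
  assumes p: "perfect_tree p" "p \<subseteq> r" and x0: "x0 \<in> FBlocks" and nr: "never_reached p x0 s"
  shows "\<exists>q Y. perfect_tree q \<and> q \<subseteq> p \<and> Y \<in> U \<and> avoidable C q Y x0 s"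
proof -
  \<comment> \<open>The threshold \<open>m\<close> appears because the final \<open>Y\<close> is
    only almost below the filter member delivered by \<open>never_reached_step\<close>.\<close>
  define \<Phi> where "\<Phi> x q Y \<longleftrightarrow> (\<forall>f\<in>branches q. reachable f Y x s) \<or>
    (\<exists>m. \<forall>y\<in>bspan Y. supp y \<noteq> {} \<longrightarrow> m < Min (supp y) \<longrightarrow> above x y \<longrightarrow> stay q (x @ [y]) s)" for x q Y
  obtain q Y where q: "perfect_tree q" "q \<subseteq> p" "Y \<in> U" "ble Y W"
    and lev: "\<And>x. x \<in> FBlocks \<Longrightarrow> \<exists>N. \<forall>t\<in>q. length t = N \<longrightarrow> \<Phi> x (tcone q t) Y"
  proof (rule fusion[OF p(1) W countable_FBlocks, of \<Phi>])
    fix x q Y q' Y'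
    assume A: "\<Phi> x q Y" "q' \<subseteq> q" "Y' \<in> U" "ble_star Y' Y"
    from A(1) show "\<Phi> x q' Y'"
      unfolding \<Phi>_def
    proof (elim disjE exE)
      assume "\<forall>f\<in>branches q. reachable f Y x s"
      then have "\<forall>f\<in>branches q'. reachable f Y' x s" using branches_mono[OF A(2)] reachable_mono[OF _ A(4,3)] by blast
      then show "(\<forall>f\<in>branches q'. reachable f Y' x s) \<or> (\<exists>m. \<forall>y\<in>bspan Y'. supp y \<noteq> {} \<longrightarrow>
        m < Min (supp y) \<longrightarrow> above x y \<longrightarrow> stay q' (x @ [y]) s)" ..
    next
      fix m assume m: "\<forall>y\<in>bspan Y. supp y \<noteq> {} \<longrightarrow> m < Min (supp y) \<longrightarrow> above x y \<longrightarrow> stay q (x @ [y]) s"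
      note B = U_Blocks[OF A(3)]
      obtain m' where m': "\<forall>v\<in>bspan Y'. (\<forall>i\<le>m'. v i = 0) \<longrightarrow> v \<in> bspan Y"
        using A(4) ble_star_iff[OF B] by blast
      have "stay q' (x @ [y]) s" if y: "y \<in> bspan Y'" "supp y \<noteq> {}" "max m m' < Min (supp y)" "above x y" for y
      proof -
        have "y \<in> bspan Y" using m' y less_Min_supp_iff[of y m'] bspan_Evec[OF B] by auto
        then show ?thesis using m y stay_mono[OF _ A(2)] by simp
      qed
      then show "(\<forall>f\<in>branches q'. reachable f Y' x s) \<or> (\<exists>m. \<forall>y\<in>bspan Y'. supp y \<noteq> {} \<longrightarrow>
        m < Min (supp y) \<longrightarrow> above x y \<longrightarrow> stay q' (x @ [y]) s)" by blast
    qed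
  next
    fix x :: "'f vec list" and q assume x: "x \<in> FBlocks" and q: "perfect_tree q" "q \<subseteq> p"
    show "\<exists>q' Y. perfect_tree q' \<and> q' \<subseteq> q \<and> Y \<in> U \<and> \<Phi> x q' Y"
    proof (cases "never_reached q x s")
      case True
      then show ?thesis using never_reached_step[OF q(1) _ x True] q(2) p(2) unfolding \<Phi>_def by blast
    qed (auto simp: never_reached_def \<Phi>_def)
  qed blast
  have qr: "q \<subseteq> r" using q p by blast
  note YB = U_Blocks[OF q(3)]
  define L where "L x \<longleftrightarrow> (\<forall>f\<in>branches q. \<exists>n. never_reached (tcone q (ini f n)) x s)" for x
  have L0: "L x0"
    unfolding L_def using never_reached_mono[OF nr] tcone_subset q(2) by blast
  have key: "\<exists>m. \<forall>y\<in>bspan Y. supp y \<noteq> {} \<longrightarrow> m < Min (supp y) \<longrightarrow> above x y \<longrightarrow>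
      L (x @ [y]) \<and> (\<forall>n. avoidable C q Y (x @ [y]) (s @ [n]))" if x: "x \<in> FBlocks" and Lx: "L x" for x
  proof -
    obtain N where N: "\<And>t. t \<in> q \<Longrightarrow> length t = N \<Longrightarrow> \<Phi> x (tcone q t) Y" using lev[OF x] by blast
    let ?S = "{t \<in> q. length t = N}"
    have "\<exists>m. \<forall>y\<in>bspan Y. supp y \<noteq> {} \<longrightarrow> m < Min (supp y) \<longrightarrow> above x y \<longrightarrow> stay (tcone q t) (x @ [y]) s"
      if t: "t \<in> ?S" for t
    proof (rule ccontr)
      assume "\<not> ?thesis"
      \<comment> \<open>Without a threshold the requirement at \<open>t\<close> says that
        \<open>x\<close> is reachable along the whole cone; a smaller cone about one of its branches
        contradicts \<open>L x\<close>.\<close>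
      then have R: "\<forall>f\<in>branches (tcone q t). reachable f Y x s" using N[of t] t by (auto simp: \<Phi>_def)
      obtain f where f: "f \<in> branches (tcone q t)"
        using branches_nonempty[OF perfect_tree_tcone[OF q(1)]] t by blast
      note fq = branches_tconeD[OF f]
      obtain n where n: "never_reached (tcone q (ini f n)) x s" using Lx fq by (auto simp: L_def)
      let ?q = "tcone q (ini f (max n N))"
      have "?q \<subseteq> tcone q (ini f n)" "?q \<subseteq> tcone q t"
        using tcone_ini_antimono[of n "max n N" q f] tcone_ini_antimono[of N "max n N" q f] fq(2) t by auto
      then show False
        using n R perfect_tcone_ini[OF q(1) fq(1)] q(3) branches_mono unfolding never_reached_def by blast
    qed
    then have "\<exists>m. \<forall>t\<in>?S. \<forall>y\<in>bspan Y. supp y \<noteq> {} \<longrightarrow> m t < Min (supp y) \<longrightarrow> above x y \<longrightarrow>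
      stay (tcone q t) (x @ [y]) s" by (intro bchoice) blast
    then obtain m where m: "\<And>t y. t \<in> ?S \<Longrightarrow> y \<in> bspan Y \<Longrightarrow> supp y \<noteq> {} \<Longrightarrow> m t < Min (supp y) \<Longrightarrow>
      above x y \<Longrightarrow> stay (tcone q t) (x @ [y]) s" by blast
    have "L (x @ [y]) \<and> (\<forall>n. avoidable C q Y (x @ [y]) (s @ [n]))"
      if y: "y \<in> bspan Y" "supp y \<noteq> {}" "Max (m ` ?S) < Min (supp y)" "above x y" for y
    proof -
      have st: "stay (tcone q (ini f N)) (x @ [y]) s" if f: "f \<in> branches q" for f
      proof (rule m)
        show S: "ini f N \<in> ?S" using ini_in_tree[OF f] by simp
        have "m (ini f N) \<le> Max (m ` ?S)" using S by (intro Max_ge finite_imageI finite_level) blast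
        then show "m (ini f N) < Min (supp y)" using y(3) by linarith
      qed (use y in auto)
      have "L (x @ [y])"
        unfolding L_def
      proof
        fix f assume f: "f \<in> branches q"
        obtain n where n: "never_reached (tcone (tcone q (ini f N)) (ini f n)) (x @ [y]) s"
          using st[OF f] branches_tcone[OF f] unfolding stay_def by blast
        have "tcone q (ini f (max n N)) \<subseteq> tcone (tcone q (ini f N)) (ini f n)"
          using tcone_ini_antimono[of n "max n N" q f] tcone_ini_antimono[of N "max n N" q f]
          by (auto simp: tcone_def)
        then show "\<exists>n. never_reached (tcone q (ini f n)) (x @ [y]) s" using never_reached_mono[OF n] by blast
      qed
      moreover have "avoidable C q Y (x @ [y]) (s @ [n])" for n
      proof (rule not_unavoidable[OF q(1) qr q(3) ble_imp_star[OF q(4)]])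
        show "x @ [y] \<in> FBlocks" using FBlocks_snoc[OF x _ y(2,4)] bspan_Evec[OF YB] y(1) by blast
        show "\<not> unavoidable f (x @ [y]) (s @ [n])" if "f \<in> branches q" for f
          using st[OF that] branches_tcone[OF that] unfolding stay_def by blast
      qed
      ultimately show ?thesis by blast
    qed
    then show ?thesis by blast
  qed
  have "\<exists>m. \<forall>x\<in>{x \<in> FBlocks. L x}. \<forall>y\<in>bspan Y. supp y \<noteq> {} \<longrightarrow> m x < Min (supp y) \<longrightarrow> above x y \<longrightarrow>
      L (x @ [y]) \<and> (\<forall>n. avoidable C q Y (x @ [y]) (s @ [n]))"
    by (intro bchoice ballI key) auto
  then obtain m where m: "\<And>x y. x \<in> FBlocks \<Longrightarrow> L x \<Longrightarrow> y \<in> bspan Y \<Longrightarrow> supp y \<noteq> {} \<Longrightarrow> m x < Min (supp y) \<Longrightarrow>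
      above x y \<Longrightarrow> L (x @ [y]) \<and> (\<forall>n. avoidable C q Y (x @ [y]) (s @ [n]))"
    by blast
  define \<tau> where "\<tau> x n = (SOME \<sigma>. \<forall>f\<in>branches q. \<forall>z\<in>outcomes_F x Y \<sigma>. \<not> has_witness C (s @ [n]) f z)" for x n
  have \<tau>: "\<forall>f\<in>branches q. \<forall>z\<in>outcomes_F x Y (\<tau> x n). \<not> has_witness C (s @ [n]) f z" if "avoidable C q Y x (s @ [n])" for x n
    using that unfolding \<tau>_def avoidable_def by (rule someI_ex)
  \<comment> \<open>I obeys the threshold of the current position and, for all \<open>i\<close> and
    \<open>n\<close> up to the number of moves made, the avoiding strategy started at time
    \<open>i\<close> for the label \<open>s @ [n]\<close>, fed with the moves made since
    then.\<close>
  define \<sigma> where "\<sigma> ys = Max (insert (m (x0 @ ys))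
    ((\<lambda>(i, n). \<tau> (x0 @ take i ys) n (drop i ys)) ` ({..length ys} \<times> {..length ys})))" for ys
  have \<sigma>m: "m (x0 @ ys) \<le> \<sigma> ys" for ys unfolding \<sigma>_def by (intro Max_ge) auto
  have \<sigma>\<tau>: "\<tau> (x0 @ take i ys) n (drop i ys) \<le> \<sigma> ys" if "i \<le> length ys" "n \<le> length ys" for i n ys
    unfolding \<sigma>_def using that by (intro Max_ge) auto
  have "\<not> has_witness C s f z" if f: "f \<in> branches q" and z: "z \<in> outcomes_F x0 Y \<sigma>" for f z
  proof
    assume "has_witness C s f z"
    then obtain b where b: "ini b (length s) = s" "C b f z" by (auto simp: has_witness_def)
    obtain y where y: "z = app x0 y" "\<And>k. supp (y k) \<noteq> {}" "\<And>k. y k \<in> bspan Y"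
      "\<And>k. \<sigma> (ini y k) < Min (supp (y k))" "above x0 (y 0)"
      "\<And>k. Max (supp (y k)) < Min (supp (y (Suc k)))"
      using z unfolding outcomes_F_def by blast
    have ab: "above (x0 @ ini y k) (y k)" for k
    proof (cases k)
      case 0
      then show ?thesis using y(5) by simp
    next
      case (Suc j)
      then show ?thesis using above_snoc[of x0 y j] y(6) by simp
    qed
    have pos: "x0 @ ini y k \<in> FBlocks \<and> L (x0 @ ini y k)" for k
    proof (induction k)
      case 0
      then show ?case using x0 L0 by simp
    next
      case (Suc k)
      have "m (x0 @ ini y k) < Min (supp (y k))" using \<sigma>m[of "ini y k"] y(4)[of k] by linarith
      then show ?case
        using m[OF _ _ y(3,2) _ ab, of k] FBlocks_snoc[OF _ _ y(2) ab, of k] Suc bspan_Evec[OF YB] y(3)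
        by (auto simp: subset_iff)
    qed
    \<comment> \<open>The next value of the witness \<open>b\<close> after \<open>s\<close> selects
      the piece in which the outcome lies. Time \<open>Suc n\<close> is late enough for this
      \<open>n\<close> to be among the labels served, and at least one move has been made, so that
      the piece is avoidable at the current position.\<close>
    define n where "n = b (length s)"
    define i where "i = Suc n"
    have "m (x0 @ ini y n) < Min (supp (y n))" using \<sigma>m[of "ini y n"] y(4)[of n] by linarith
    then have "avoidable C q Y (x0 @ ini y i) (s @ [n])"
      using m[OF _ _ y(3,2) _ ab, of n] pos[of n] by (simp add: i_def)
    moreover have "z \<in> outcomes_F (x0 @ ini y i) Y (\<tau> (x0 @ ini y i) n)"
      unfolding outcomes_F_def
    proof (intro CollectI exI[of _ "\<lambda>k. y (k + i)"] conjI allI)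
      show "z = app (x0 @ ini y i) (\<lambda>k. y (k + i))"
        unfolding y(1) app_shift ..
      fix k
      have "drop i (ini y (k + i)) = ini (\<lambda>k. y (k + i)) k"
        by (auto simp: drop_map intro!: nth_equalityI) (simp add: add.commute)
      then show "\<tau> (x0 @ ini y i) n (ini (\<lambda>k. y (k + i)) k) < Min (supp (y (k + i)))"
        using \<sigma>\<tau>[of i "ini y (k + i)" n] y(4)[of "k + i"] take_ini[of i "k + i" y] by (simp add: i_def)
    qed (use y ab[of i] in auto)
    moreover have "has_witness C (s @ [n]) f z"
      using b by (auto simp: has_witness_def n_def)
    ultimately show False using \<tau> f by blast
  qed
  then have "avoidable C q Y x0 s" unfolding avoidable_def by blast
  then show ?thesis using q by blast
qed

end

section \<open>Strategies of II and Borel sets\<close>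

text \<open>A strategy of II, good until the target of \<open>reach\<close> is attained: \<open>Play g h\<close> answers \<open>Z\<close>
  with the vector \<open>g Z\<close> and continues with \<open>h Z\<close>. Trees being well-founded, the target is
  attained after finitely many moves.\<close>
datatype ('z, 'v) stree = Done | Play (answer: "'z \<Rightarrow> 'v") (cont: "'z \<Rightarrow> ('z, 'v) stree")

primrec valid :: "('f vec list \<Rightarrow> bool) \<Rightarrow> ('f::comm_ring_1) bseq \<Rightarrow>
    ('f bseq, 'f vec) stree \<Rightarrow> 'f vec list \<Rightarrow> bool" where
  "valid P Y Done = P"
| "valid P Y (Play g h) = (\<lambda>x. \<forall>Z. Z \<in> Blocks \<longrightarrow> ble Z Y \<longrightarrow>
    g Z \<in> bspan Z \<and> supp (g Z) \<noteq> {} \<and> above x (g Z) \<and> valid P Y (h Z) (x @ [g Z]))"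

text \<open>Choosing an answer and a continuation for every move of I turns the derivation into a
  strategy tree. It is not \<open>Done\<close>, since \<open>reach\<close> requires a move; so
  restarting it always advances the game.\<close>

lemma reach_imp_valid:
  assumes "reach P Y x"
  shows "\<exists>T. T \<noteq> Done \<and> valid P Y T x"
  using assms
proof (induction rule: reach.induct)
  case (reachI x)
  have "\<forall>Z. \<exists>y T. Z \<in> Blocks \<longrightarrow> ble Z Y \<longrightarrow>
      y \<in> bspan Z \<and> supp y \<noteq> {} \<and> above x y \<and> valid P Y T (x @ [y])"
  proof (intro allI)
    fix Z
    show "\<exists>y T. Z \<in> Blocks \<longrightarrow> ble Z Y \<longrightarrow>
      y \<in> bspan Z \<and> supp y \<noteq> {} \<and> above x y \<and> valid P Y T (x @ [y])"
    proof (cases "Z \<in> Blocks \<and> ble Z Y")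
      case True
      then obtain y where y: "y \<in> bspan Z" "supp y \<noteq> {}" "above x y"
        and alt: "P (x @ [y]) \<or> (\<exists>T. T \<noteq> Done \<and> valid P Y T (x @ [y]))"
        using reachI by blast
      have "P (x @ [y]) \<Longrightarrow> valid P Y Done (x @ [y])" by simp
      then show ?thesis using y alt by blast
    qed blast
  qed
  then obtain g h where "\<forall>Z. Z \<in> Blocks \<longrightarrow> ble Z Y \<longrightarrow>
      g Z \<in> bspan Z \<and> supp (g Z) \<noteq> {} \<and> above x (g Z) \<and> valid P Y (h Z) (x @ [g Z])"
    by metis
  then show ?case by (intro exI[of _ "Play g h"]) simp
qed

text \<open>Closedness in the product of Baire space, Cantor space and the space of block sequences;
  the first \<open>M\<close> values of the three coordinates give the basic neighbourhoods.\<close>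

definition seq_closed :: "((nat \<Rightarrow> nat) \<Rightarrow> (nat \<Rightarrow> bool) \<Rightarrow> ('f::zero) bseq \<Rightarrow> bool) \<Rightarrow> bool" where
  "seq_closed C \<longleftrightarrow> (\<forall>b f z. z \<in> Blocks \<longrightarrow> (\<forall>M. \<exists>b' f' z'. z' \<in> Blocks \<and> ini b' M = ini b M \<and>
    ini f' M = ini f M \<and> ini z' M = ini z M \<and> C b' f' z') \<longrightarrow> C b f z)"

lemma seq_closedD:
  assumes "seq_closed C" "z \<in> Blocks"
    and "\<And>M. \<exists>b' f' z'. z' \<in> Blocks \<and> ini b' M = ini b M \<and> ini f' M = ini f M \<and> ini z' M = ini z M \<and> C b' f' z'"
  shows "C b f z"
  using assms unfolding seq_closed_def by blast

context decided
begin

text \<open>II concatenates finite strategies, each leading to an unavoidable position with a label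
  one longer. The labels converge to \<open>b\<close>. Each of these positions is met by points of
  \<open>C\<close> arbitrarily near in all three coordinates, so closedness puts the limit into
  \<open>C\<close>.\<close>

lemma II_strategy:
  assumes cl: "seq_closed C" and f: "f \<in> branches r" and Y: "Y \<in> U" and x0: "x0 \<in> FBlocks"
    and VR: "\<And>x s. x \<in> FBlocks \<Longrightarrow> unavoidable f x s \<Longrightarrow> reachable f Y x s" and V0: "unavoidable f x0 []"
  shows "\<exists>\<alpha>. II_strategy_G x0 Y \<alpha> \<and> (\<forall>z\<in>outcomes_G x0 Y \<alpha>. \<exists>b. C b f z)"
proof -
  define P where "P s x \<longleftrightarrow> (\<exists>n. unavoidable f x (s @ [n]))" for s x
  define start where "start x s = (SOME T. T \<noteq> Done \<and> valid (P s) Y T x)" for x s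
  have start: "start x s \<noteq> Done \<and> valid (P s) Y (start x s) x" if "x \<in> FBlocks" "unavoidable f x s" for x s
    using reach_imp_valid[OF VR[OF that, unfolded reachable_def]] unfolding start_def P_def[abs_def] by (rule someI_ex)
  \<comment> \<open>The state consists of the position, its label and what remains of the current
    finite strategy. When that is \<open>Done\<close>, the label is extended by a number that keeps
    the position unavoidable and a new strategy begins.\<close>
  define nxt where "nxt = (\<lambda>(x, s, T) Z. let x' = x @ [answer T Z] in
    if cont T Z = Done then (let s' = s @ [SOME n. unavoidable f x' (s @ [n])] in (x', s', start x' s'))
    else (x', s, cont T Z))"
  define st where "st = rec_list (x0, [], start x0 []) (\<lambda>Z _ a. nxt a Z)"
  define \<alpha> where "\<alpha> Zs = last (fst (st (rev Zs)))" for Zs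
  define inv where "inv = (\<lambda>(x, s, T). x \<in> FBlocks \<and> T \<noteq> Done \<and> valid (P s) Y T x)"
  have inv_nxt: "inv (nxt (x, s, T) Z)" "answer T Z \<in> bspan Z" "supp (answer T Z) \<noteq> {}" "above x (answer T Z)"
    "cont T Z = Done \<Longrightarrow> \<exists>n T'. nxt (x, s, T) Z = (x @ [answer T Z], s @ [n], T') \<and> unavoidable f (x @ [answer T Z]) (s @ [n])"
    if i: "inv (x, s, T)" and Z: "Z \<in> Blocks" "ble Z Y" for x s T Z
  proof -
    obtain g h where T: "T = Play g h" using i by (cases T) (auto simp: inv_def)
    have v: "g Z \<in> bspan Z" "supp (g Z) \<noteq> {}" "above x (g Z)" "valid (P s) Y (h Z) (x @ [g Z])"
      using i Z by (auto simp: inv_def T)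
    then show "answer T Z \<in> bspan Z" "supp (answer T Z) \<noteq> {}" "above x (answer T Z)" by (auto simp: T)
    have x': "x @ [g Z] \<in> FBlocks"
      using FBlocks_snoc[of x "g Z"] v i bspan_Evec[OF Z(1)] by (auto simp: inv_def)
    let ?n = "SOME n. unavoidable f (x @ [g Z]) (s @ [n])"
    have V: "unavoidable f (x @ [g Z]) (s @ [?n])" if "h Z = Done"
      using v(4) that unfolding P_def by (auto intro: someI_ex)
    then show "cont T Z = Done \<Longrightarrow>
        \<exists>n T'. nxt (x, s, T) Z = (x @ [answer T Z], s @ [n], T') \<and> unavoidable f (x @ [answer T Z]) (s @ [n])"
      by (auto simp: nxt_def T Let_def)
    show "inv (nxt (x, s, T) Z)"
      using V start[OF x', of "s @ [?n]"] x' v(4) by (auto simp: nxt_def inv_def T Let_def)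
  qed
  have inv0: "inv (x0, [], start x0 [])" using start[OF x0 V0] x0 by (simp add: inv_def)
  have main: "(\<forall>k. supp (II_moves \<alpha> Ys k) \<noteq> {} \<and> II_moves \<alpha> Ys k \<in> bspan (Ys k)) \<and>
      above x0 (II_moves \<alpha> Ys 0) \<and>
      (\<forall>k. Max (supp (II_moves \<alpha> Ys k)) < Min (supp (II_moves \<alpha> Ys (Suc k)))) \<and>
      (\<exists>b. C b f (app x0 (II_moves \<alpha> Ys)))"
    if Ys: "Ys \<in> I_plays_G Y" for Ys
  proof -
    have B: "Ys k \<in> Blocks" "ble (Ys k) Y" for k using Ys by (auto simp: I_plays_G_def)
    define S where "S k = st (rev (ini Ys k))" for k
    define X where "X k = fst (S k)" for k
    define s where "s k = fst (snd (S k))" for k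
    define T where "T k = snd (snd (S k))" for k
    define y where "y = II_moves \<alpha> Ys"
    have S: "S k = (X k, s k, T k)" for k by (simp add: X_def s_def T_def)
    have S0: "S 0 = (x0, [], start x0 [])" by (simp add: S_def st_def)
    have SSuc: "S (Suc k) = nxt (S k) (Ys k)" for k by (simp add: S_def st_def)
    have invS: "inv (S k)" for k
    proof (induction k)
      case 0
      then show ?case using inv0 S0 by simp
    next
      case (Suc k)
      then show ?case using inv_nxt(1)[OF _ B, of "X k" "s k" "T k" k] unfolding SSuc S[of k] by simp
    qed
    have iS: "inv (X k, s k, T k)" for k using invS[of k] unfolding S .
    have XSuc: "X (Suc k) = X k @ [answer (T k) (Ys k)]" for k
      using SSuc[of k] unfolding S[of k] X_def[of "Suc k"] by (auto simp: nxt_def Let_def)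
    have yk: "y k = answer (T k) (Ys k)" for k
    proof -
      have "y k = last (X (Suc k))" by (simp add: y_def II_moves_def \<alpha>_def X_def S_def)
      then show ?thesis using XSuc by simp
    qed
    have Xk: "X k = x0 @ ini y k" for k
      by (induction k) (use S0 in \<open>auto simp: X_def[of 0] XSuc yk\<close>)
    have moves: "y k \<in> bspan (Ys k)" "supp (y k) \<noteq> {}" "above (x0 @ ini y k) (y k)" for k
      using inv_nxt(2-4)[OF iS B, of k k] by (simp_all add: yk Xk)
    have yE: "y k \<in> Evec" for k using moves(1) bspan_Evec[OF B(1)] by blast
    have incr: "Max (supp (y k)) < Min (supp (y (Suc k)))" for k
      using moves(3)[of "Suc k"] unfolding above_snoc .
    have ab0: "above x0 (y 0)" using moves(3)[of 0] by simp
    have zB: "app x0 y \<in> Blocks" by (rule app_Blocks[OF x0 yE moves(2) ab0 incr])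
    have sdone: "\<exists>n. s (Suc k) = s k @ [n] \<and> unavoidable f (X (Suc k)) (s (Suc k))" if Dn: "cont (T k) (Ys k) = Done" for k
    proof -
      obtain n T' where "S (Suc k) = (X k @ [answer (T k) (Ys k)], s k @ [n], T')"
        "unavoidable f (X k @ [answer (T k) (Ys k)]) (s k @ [n])"
        using inv_nxt(5)[OF iS B Dn] unfolding SSuc S[of k] by blast
      then show ?thesis by (simp add: s_def[of "Suc k"] X_def[of "Suc k"])
    qed
    have sno: "s (Suc k) = s k \<and> T (Suc k) = cont (T k) (Ys k)" if "cont (T k) (Ys k) \<noteq> Done" for k
      using that SSuc[of k] unfolding S[of k] s_def[of "Suc k"] T_def[of "Suc k"] by (auto simp: nxt_def Let_def)
    have spre: "prefix (s k) (s (k + j))" for k j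
    proof (induction j)
      case (Suc j)
      have "prefix (s (k + j)) (s (Suc (k + j)))"
        using sdone[of "k + j"] sno[of "k + j"] by (cases "cont (T (k + j)) (Ys (k + j)) = Done") auto
      then show ?case using prefix_order.trans[OF Suc] by simp
    qed simp
    have ev: "\<exists>j\<ge>k. cont (T j) (Ys j) = Done" for k
    proof -
      \<comment> \<open>Induction on the strategy tree: each move passes to a subtree, so the
        current strategy ends. The case \<open>Done\<close> cannot occur, since \<open>inv\<close>
        excludes it.\<close>
      have "\<forall>k. T k = t \<longrightarrow> (\<exists>j\<ge>k. cont (T j) (Ys j) = Done)" for t
      proof (induction t)
        case Done
        then show ?case using iS by (auto simp: inv_def)
      next
        case (Play g h)
        show ?case
        proof (intro allI impI)
          fix k assume k: "T k = Play g h"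
          show "\<exists>j\<ge>k. cont (T j) (Ys j) = Done"
          proof (cases "h (Ys k) = Done")
            case True
            then show ?thesis using k by (intro exI[of _ k]) simp
          next
            case False
            then have "T (Suc k) = h (Ys k)" using sno[of k] k by simp
            then obtain j where "j \<ge> Suc k" "cont (T j) (Ys j) = Done"
              using Play[of "h (Ys k)"] by blast
            then show ?thesis using Suc_leD by blast
          qed
        qed
      qed
      then show ?thesis by blast
    qed
    have long: "\<exists>k. length (s k) \<ge> M" for M
    proof (induction M)
      case (Suc M)
      then obtain k where k: "length (s k) \<ge> M" by blast
      obtain j where j: "j \<ge> k" "cont (T j) (Ys j) = Done" using ev by blast
      then have "length (s j) \<ge> length (s k)"
        using prefix_length_le[OF spre[of k "j - k"]] by simp
      then show ?case using sdone[OF j(2)] k by (intro exI[of _ "Suc j"]) auto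
    qed simp
    \<comment> \<open>The union of the labels, which form a chain of prefixes of unbounded
      length.\<close>
    define b where "b i = s (SOME k. length (s k) > i) ! i" for i
    have b: "ini b (length (s k)) = s k" for k
    proof (rule nth_equalityI)
      fix i assume "i < length (ini b (length (s k)))"
      then have i: "i < length (s k)" by simp
      define k' where "k' = (SOME k. length (s k) > i)"
      have k': "length (s k') > i" unfolding k'_def using i by (rule someI)
      have "prefix (s k) (s k') \<or> prefix (s k') (s k)"
        using spre[of k "k' - k"] spre[of k' "k - k'"] by (cases "k \<le> k'") auto
      then have "s k' ! i = s k ! i" using i k' by (auto simp: prefix_def nth_append)
      then show "ini b (length (s k)) ! i = s k ! i" using i by (simp add: b_def k'_def)
    qed simp
    have "C b f (app x0 y)"
    proof (rule seq_closedD[OF cl zB])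
      fix M
      obtain k where k: "length (s k) \<ge> M" using long by blast
      obtain j where j: "j \<ge> max k M" "cont (T j) (Ys j) = Done" using ev by blast
      then obtain V: "unavoidable f (X (Suc j)) (s (Suc j))" using sdone by blast
      have sl: "length (s (Suc j)) \<ge> M"
        using prefix_length_le[OF spre[of k "Suc j - k"]] k j(1) by simp
      \<comment> \<open>Unavoidability is used against the strategy of I that always plays 0: its
        failure on the cone of \<open>ini f M\<close> provides a nearby branch, outcome and witness
        in \<open>C\<close>. Position and label both have length at least \<open>M\<close> by the
        choice of \<open>j\<close>.\<close>
      have "\<not> avoidable C (tcone r (ini f M)) W (X (Suc j)) (s (Suc j))" using V by (simp add: unavoidable_def)
      then obtain f' z' where f': "f' \<in> branches (tcone r (ini f M))"
        and z': "z' \<in> outcomes_F (X (Suc j)) W (\<lambda>_. 0)" and w: "has_witness C (s (Suc j)) f' z'"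
        unfolding avoidable_def by blast
      obtain b' where b': "ini b' (length (s (Suc j))) = s (Suc j)" "C b' f' z'"
        using w by (auto simp: has_witness_def)
      have "X (Suc j) \<in> FBlocks" using iS[of "Suc j"] by (simp add: inv_def)
      then have "z' \<in> Blocks" using outcomes_F_Blocks[OF _ U_Blocks[OF W]] z' by blast
      moreover have "ini b' M = ini b M"
        using take_ini[OF sl, of b'] take_ini[OF sl, of b] b[of "Suc j"] b'(1) by simp
      moreover have "ini f' M = ini f M" using branches_tconeD(2)[OF f'] by simp
      moreover have "ini z' M = ini (app x0 y) M"
      proof -
        obtain y' where "z' = app (X (Suc j)) y'" using z' unfolding outcomes_F_def by blast
        then have 1: "ini z' (length (X (Suc j))) = X (Suc j)" using ini_app by metis
        have "app x0 y = app (X (Suc j)) (\<lambda>k. y (k + Suc j))"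
          unfolding Xk app_shift ..
        then have 2: "ini (app x0 y) (length (X (Suc j))) = X (Suc j)" using ini_app by metis
        have "M \<le> length (X (Suc j))" using j(1) by (simp add: Xk)
        then show ?thesis using take_ini[of M "length (X (Suc j))"] 1 2 by metis
      qed
      ultimately show "\<exists>b' f' z'. z' \<in> Blocks \<and> ini b' M = ini b M \<and> ini f' M = ini f M \<and>
          ini z' M = ini (app x0 y) M \<and> C b' f' z'" using b'(2) by blast
    qed
    then show ?thesis using moves ab0 incr unfolding y_def by blast
  qed
  show ?thesis
  proof (intro exI[of _ \<alpha>] conjI ballI)
    show "II_strategy_G x0 Y \<alpha>" unfolding II_strategy_G_def using main by blast
    fix z assume "z \<in> outcomes_G x0 Y \<alpha>"
    then show "\<exists>b. C b f z" using main unfolding outcomes_G_def by blast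
  qed
qed

end

section \<open>The dichotomy for analytic sets\<close>

context strategic_pplus
begin

text \<open>If some pair makes the empty label avoidable at \<open>x0\<close>, alternative (i)
  follows. Otherwise a first fusion decides avoidability and a second makes every position and label
  avoidable or reachable near each branch. Unavoidable positions are then reachable, which is what
  \<open>II_strategy\<close> needs.\<close>

lemma analytic_dichotomy:
  assumes cl: "seq_closed C" and x0: "x0 \<in> FBlocks" and X: "X \<in> U" and p: "perfect_tree p"
  shows "\<exists>Y\<in>restr U X. \<exists>q. perfect_tree q \<and> q \<subseteq> p \<and>
    ((\<exists>\<sigma>. \<forall>f\<in>branches q. \<forall>z\<in>outcomes_F x0 Y \<sigma>. \<not> (\<exists>b. C b f z)) \<or>
     (\<forall>f\<in>branches q. \<exists>\<alpha>. II_strategy_G x0 Y \<alpha> \<and> (\<forall>z\<in>outcomes_G x0 Y \<alpha>. \<exists>b. C b f z)))"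
proof (cases "\<exists>q Y. perfect_tree q \<and> q \<subseteq> p \<and> Y \<in> U \<and> avoidable C q Y x0 []")
  case True
  then obtain q Y where q: "perfect_tree q" "q \<subseteq> p" "Y \<in> U" "avoidable C q Y x0 []" by blast
  obtain Z where Z: "Z \<in> U" "ble Z X" "ble Z Y" using U_lower[OF X q(3)] by blast
  have "avoidable C q Z x0 []" using avoidable_mono[OF q(4) subset_refl ble_imp_star[OF Z(3)] U_Blocks[OF Z(1)]] .
  then have "\<exists>\<sigma>. \<forall>f\<in>branches q. \<forall>z\<in>outcomes_F x0 Z \<sigma>. \<not> (\<exists>b. C b f z)"
    by (simp add: avoidable_def has_witness_def)
  then show ?thesis using q(1,2) Z(1,2) unfolding restr_def by blast
next
  case False
  define \<Phi> where "\<Phi> = (\<lambda>(x, s) q Y. avoidable C q Y x s \<or>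
      (\<forall>q' Y. perfect_tree q' \<longrightarrow> q' \<subseteq> q \<longrightarrow> Y \<in> U \<longrightarrow> \<not> avoidable C q' Y x s))"
  have cnt: "countable ((FBlocks :: 'f vec list set) \<times> (UNIV :: nat list set))"
    by (intro countable_SIGMA countable_FBlocks countableI_type)
  obtain r W where rW: "perfect_tree r" "r \<subseteq> p" "W \<in> U" "ble W X"
    and lev: "\<And>i. i \<in> FBlocks \<times> UNIV \<Longrightarrow> \<exists>N. \<forall>t\<in>r. length t = N \<longrightarrow> \<Phi> i (tcone r t) W"
  proof (rule fusion[OF p X cnt, of \<Phi>])
    fix i q q' Y Y'
    assume A: "\<Phi> i q Y" "q' \<subseteq> q" "Y' \<in> U" "ble_star Y' Y"
    obtain x s where i: "i = (x, s)" by fastforce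
    show "\<Phi> i q' Y'"
      using A(1) avoidable_mono[OF _ A(2,4) U_Blocks[OF A(3)], of C x s] A(2) unfolding \<Phi>_def i prod.case by blast
  next
    fix i :: "'f vec list \<times> nat list" and q :: "bool list set"
    assume q: "perfect_tree q"
    obtain x s where i: "i = (x, s)" by fastforce
    show "\<exists>q' Y. perfect_tree q' \<and> q' \<subseteq> q \<and> Y \<in> U \<and> \<Phi> i q' Y"
    proof (cases "\<exists>q' Y. perfect_tree q' \<and> q' \<subseteq> q \<and> Y \<in> U \<and> avoidable C q' Y x s")
      case True
      then show ?thesis unfolding \<Phi>_def i prod.case by blast
    next
      case False
      then have "\<Phi> i q X" unfolding \<Phi>_def i prod.case by blast
      then show ?thesis using q X by blast
    qed
  qed blast
  interpret decided U C r W
  proof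
    fix x :: "'f vec list" and s :: "nat list"
    assume "x \<in> FBlocks"
    then show "\<exists>N. \<forall>t\<in>r. length t = N \<longrightarrow> avoidable C (tcone r t) W x s \<or>
      (\<forall>q Y. perfect_tree q \<longrightarrow> q \<subseteq> tcone r t \<longrightarrow> Y \<in> U \<longrightarrow> \<not> avoidable C q Y x s)"
      using lev[of "(x, s)"] by (simp add: \<Phi>_def)
  qed (use rW in auto)
  \<comment> \<open>This requirement is dense: \<open>never_reached_imp_avoidable\<close> gives the
    first half where \<open>never_reached\<close> holds, and its failure is the second half.\<close>
  define \<Psi> where "\<Psi> = (\<lambda>(x, s) q Y. avoidable C q Y x s \<or> (\<forall>f\<in>branches q. reachable f Y x s))"
  obtain q Y where q: "perfect_tree q" "q \<subseteq> r" "Y \<in> U" "ble Y W"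
    and levq: "\<And>i. i \<in> FBlocks \<times> UNIV \<Longrightarrow> \<exists>N. \<forall>t\<in>q. length t = N \<longrightarrow> \<Psi> i (tcone q t) Y"
  proof (rule fusion[OF rW(1,3) cnt, of \<Psi>])
    fix i q q' Y Y'
    assume A: "\<Psi> i q Y" "q' \<subseteq> q" "Y' \<in> U" "ble_star Y' Y"
    obtain x s where i: "i = (x, s)" by fastforce
    show "\<Psi> i q' Y'"
      using A(1) avoidable_mono[OF _ A(2,4) U_Blocks[OF A(3)], of C x s] reachable_mono[OF _ A(4,3), of _ x s]
        branches_mono[OF A(2)] unfolding \<Psi>_def i prod.case by blast
  next
    fix i :: "'f vec list \<times> nat list" and q
    assume i: "i \<in> FBlocks \<times> UNIV" and q: "perfect_tree q" "q \<subseteq> r"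
    obtain x s where xs: "i = (x, s)" by fastforce
    show "\<exists>q' Y. perfect_tree q' \<and> q' \<subseteq> q \<and> Y \<in> U \<and> \<Psi> i q' Y"
    proof (cases "never_reached q x s")
      case True
      then show ?thesis using never_reached_imp_avoidable[OF q _ True] i unfolding \<Psi>_def xs prod.case by blast
    next
      case False
      then show ?thesis unfolding never_reached_def \<Psi>_def xs prod.case by blast
    qed
  qed blast
  have "\<exists>\<alpha>. II_strategy_G x0 Y \<alpha> \<and> (\<forall>z\<in>outcomes_G x0 Y \<alpha>. \<exists>b. C b f z)" if f: "f \<in> branches q" for f
  proof (rule II_strategy[OF cl _ q(3) x0])
    show fr: "f \<in> branches r" using f branches_mono[OF q(2)] by blast
    show "unavoidable f x0 []"
      unfolding unavoidable_def using False perfect_tcone_ini[OF rW(1) fr] tcone_subset rW(2,3) by blast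
    fix x s assume x: "x \<in> FBlocks" and V: "unavoidable f x s"
    obtain N where N: "\<And>t. t \<in> q \<Longrightarrow> length t = N \<Longrightarrow> \<Psi> (x, s) (tcone q t) Y" using levq[of "(x, s)"] x by auto
    obtain M where M: "\<And>q Y. perfect_tree q \<Longrightarrow> q \<subseteq> tcone r (ini f M) \<Longrightarrow> Y \<in> U \<Longrightarrow> \<not> avoidable C q Y x s"
      using unavoidable_level[OF x, of s] fr V by blast
    \<comment> \<open>The levels \<open>M\<close> and \<open>N\<close> belong to different trees;
      the cone of \<open>q\<close> at the larger of the two lies in both cones, so avoidability on
      one would contradict unavoidability on the other.\<close>
    have "\<not> avoidable C (tcone q (ini f N)) Y x s"
    proof
      assume I: "avoidable C (tcone q (ini f N)) Y x s"
      let ?q = "tcone q (ini f (max M N))"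
      have "?q \<subseteq> tcone q (ini f N)" "?q \<subseteq> tcone r (ini f M)"
        using tcone_ini_antimono[of N "max M N" q f] tcone_ini_antimono[of M "max M N" q f]
          tcone_mono[OF q(2)] by (auto simp: subset_iff)
      then show False
        using M[OF perfect_tcone_ini[OF q(1) f], of "max M N" Y] q(3)
          avoidable_mono[OF I _ ble_imp_star[OF ble_refl] U_Blocks[OF q(3)]] by blast
    qed
    then have "\<forall>g\<in>branches (tcone q (ini f N)). reachable g Y x s"
      using N[OF ini_in_tree[OF f, of N]] by (simp add: \<Psi>_def)
    then show "reachable f Y x s" using branches_tcone[OF f] by blast
  qed
  then show ?thesis using q rW(2) ble_trans[OF q(4) rW(4)] by (intro bexI[of _ Y] exI[of _ q]) (auto simp: restr_def)
qed

end

section \<open>Analytic sets and countable operations\<close>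

definition analytic :: "((nat \<Rightarrow> bool) \<times> ('f::zero) bseq) set \<Rightarrow> bool" where
  "analytic A \<longleftrightarrow> (\<exists>C. seq_closed C \<and> (\<forall>f. \<forall>z\<in>Blocks. (f, z) \<in> A \<longleftrightarrow> (\<exists>b. C b f z)))"

lemma ini_eqD: "ini f n = ini g n \<Longrightarrow> i < n \<Longrightarrow> f i = g i"
  by simp

text \<open>The value \<open>b 0\<close> names a set of the union, and the rest of \<open>b\<close>
  is a witness for it.\<close>

lemma analytic_Union:
  assumes "\<And>i::nat. analytic (A i)"
  shows "analytic (\<Union>i. A i)"
proof -
  obtain C where C: "\<And>i. seq_closed (C i)" "\<And>i f z. z \<in> Blocks \<Longrightarrow> (f, z) \<in> A i \<longleftrightarrow> (\<exists>b. C i b f z)"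
    using assms unfolding analytic_def by metis
  define D where "D b f z = C (b 0) (\<lambda>n. b (Suc n)) f z" for b f z
  have "seq_closed D"
    unfolding seq_closed_def
  proof (intro allI impI)
    fix b f and z :: "'a bseq"
    assume z: "z \<in> Blocks" and lim: "\<forall>M. \<exists>b' f' z'. z' \<in> Blocks \<and> ini b' M = ini b M \<and>
      ini f' M = ini f M \<and> ini z' M = ini z M \<and> D b' f' z'"
    show "D b f z"
      unfolding D_def
    proof (rule seq_closedD[OF C(1) z])
      fix M
      obtain b' f' z' where l: "z' \<in> Blocks" "ini b' (Suc M) = ini b (Suc M)" "ini f' (Suc M) = ini f (Suc M)"
        "ini z' (Suc M) = ini z (Suc M)" "D b' f' z'" using lim by blast
      have "b' 0 = b 0" using ini_eqD[OF l(2)] by simp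
      then have "C (b 0) (\<lambda>n. b' (Suc n)) f' z'" using l(5) by (simp add: D_def)
      moreover have "ini (\<lambda>n. b' (Suc n)) M = ini (\<lambda>n. b (Suc n)) M" "ini f' M = ini f M" "ini z' M = ini z M"
        using ini_eqD[OF l(2)] ini_eqD[OF l(3)] ini_eqD[OF l(4)] by simp_all
      ultimately show "\<exists>b' f' z'. z' \<in> Blocks \<and> ini b' M = ini (\<lambda>n. b (Suc n)) M \<and>
        ini f' M = ini f M \<and> ini z' M = ini z M \<and> C (b 0) b' f' z'" using l(1) by blast
    qed
  qed
  moreover have "(f, z) \<in> (\<Union>i. A i) \<longleftrightarrow> (\<exists>b. D b f z)" if z: "z \<in> Blocks" for f z
  proof
    assume "(f, z) \<in> (\<Union>i. A i)"
    then obtain i b where "C i b f z" using C(2)[OF z] by auto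
    then show "\<exists>b. D b f z" by (intro exI[of _ "case_nat i b"]) (simp add: D_def)
  qed (use C(2)[OF z] in \<open>auto simp: D_def\<close>)
  ultimately show ?thesis unfolding analytic_def by blast
qed

text \<open>A single \<open>b\<close> codes one witness for each set, along the columns of the
  pairing function.\<close>

lemma analytic_Inter:
  assumes "\<And>i::nat. analytic (A i)"
  shows "analytic (\<Inter>i. A i)"
proof -
  obtain C where C: "\<And>i. seq_closed (C i)" "\<And>i f z. z \<in> Blocks \<Longrightarrow> (f, z) \<in> A i \<longleftrightarrow> (\<exists>b. C i b f z)"
    using assms unfolding analytic_def by metis
  define D where "D b f z = (\<forall>i. C i (\<lambda>n. b (prod_encode (i, n))) f z)" for b f z
  have "seq_closed D"
    unfolding seq_closed_def
  proof (intro allI impI)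
    fix b f and z :: "'a bseq"
    assume z: "z \<in> Blocks" and lim: "\<forall>M. \<exists>b' f' z'. z' \<in> Blocks \<and> ini b' M = ini b M \<and>
      ini f' M = ini f M \<and> ini z' M = ini z M \<and> D b' f' z'"
    show "D b f z"
      unfolding D_def
    proof (rule allI, rule seq_closedD[OF C(1) z])
      fix i M
      \<comment> \<open>The first \<open>N\<close> values of \<open>b\<close> contain the first
        \<open>M\<close> entries of column \<open>i\<close>.\<close>
      define N where "N = M + Max (insert 0 ((\<lambda>n. Suc (prod_encode (i, n))) ` {..<M}))"
      have N: "prod_encode (i, n) < N" if "n < M" for n
      proof -
        have "Suc (prod_encode (i, n)) \<le> Max (insert 0 ((\<lambda>n. Suc (prod_encode (i, n))) ` {..<M}))"
          using that by (intro Max_ge) auto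
        then show ?thesis by (simp add: N_def)
      qed
      have MN: "M \<le> N" by (simp add: N_def)
      obtain b' f' z' where l: "z' \<in> Blocks" "ini b' N = ini b N" "ini f' N = ini f N"
        "ini z' N = ini z N" "D b' f' z'" using lim by blast
      have "ini (\<lambda>n. b' (prod_encode (i, n))) M = ini (\<lambda>n. b (prod_encode (i, n))) M"
        "ini f' M = ini f M" "ini z' M = ini z M"
        using ini_eqD[OF l(2)] ini_eqD[OF l(3)] ini_eqD[OF l(4)] N MN by simp_all
      then show "\<exists>b' f' z'. z' \<in> Blocks \<and> ini b' M = ini (\<lambda>n. b (prod_encode (i, n))) M \<and>
        ini f' M = ini f M \<and> ini z' M = ini z M \<and> C i b' f' z'" using l(1,5) unfolding D_def by blast
    qed
  qed
  moreover have "(f, z) \<in> (\<Inter>i. A i) \<longleftrightarrow> (\<exists>b. D b f z)" if z: "z \<in> Blocks" for f z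
  proof
    assume "(f, z) \<in> (\<Inter>i. A i)"
    then have "\<forall>i. \<exists>b. C i b f z" using C(2)[OF z] by auto
    then obtain b where "\<And>i. C i (b i) f z" by metis
    then show "\<exists>b. D b f z"
      by (intro exI[of _ "\<lambda>k. case prod_decode k of (i, n) \<Rightarrow> b i n"]) (simp add: D_def)
  qed (use C(2)[OF z] in \<open>auto simp: D_def\<close>)
  ultimately show ?thesis unfolding analytic_def by blast
qed

section \<open>Borel sets are analytic\<close>

lemma openin_cylinder:
  assumes O: "openin (prod_topology cantor_top Einf_top) A" and fz: "(f, z) \<in> A"
  shows "\<exists>n. \<forall>f' z'. z' \<in> Blocks \<longrightarrow> ini f' n = ini f n \<longrightarrow> ini z' n = ini z n \<longrightarrow> (f', z') \<in> A"
proof -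
  obtain A1 A2 where A: "openin cantor_top A1" "openin Einf_top A2" "f \<in> A1" "z \<in> A2" "A1 \<times> A2 \<subseteq> A"
    using O[unfolded openin_prod_topology_alt, rule_format, OF fz] by blast
  obtain B where B: "openin (product_topology (\<lambda>_. discrete_topology Evec) UNIV) B" "A2 = B \<inter> Blocks"
    using A(2) unfolding Einf_top_def openin_subtopology by blast
  obtain u where u: "finite {i. u i \<noteq> (UNIV :: bool set)}" "f \<in> Pi\<^sub>E UNIV u" "Pi\<^sub>E UNIV u \<subseteq> A1"
    using A(1,3) unfolding cantor_top_def openin_product_topology_alt by (auto; blast)
  obtain v where v: "finite {i. v i \<noteq> (Evec :: 'a vec set)}" "z \<in> Pi\<^sub>E UNIV v" "Pi\<^sub>E UNIV v \<subseteq> B"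
    using A(4) B unfolding openin_product_topology_alt by (auto; blast)
  obtain n where n: "\<forall>i\<in>{i. u i \<noteq> UNIV} \<union> {i. v i \<noteq> Evec}. i < n"
    using finite_nat_set_iff_bounded u(1) v(1) by (metis finite_UnI)
  show ?thesis
  proof (intro exI[of _ n] allI impI)
    fix f' z' assume z': "z' \<in> Blocks" and eq: "ini f' n = ini f n" "ini z' n = ini z n"
    have "f' i \<in> u i" for i
      using u(2) eq(1) n by (cases "i < n") (auto simp: PiE_iff map_eq_conv)
    then have "f' \<in> A1" using u(3) by (auto simp: PiE_iff)
    have "z' i \<in> v i" for i
    proof (cases "i < n")
      case True
      then show ?thesis using v(2) eq(2) by (auto simp: PiE_iff map_eq_conv)
    next
      case False
      then have "v i = Evec" using n by auto
      then show ?thesis using z' by (auto simp: Blocks_def is_block_def)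
    qed
    then have "z' \<in> B" using v(3) by (auto simp: PiE_iff)
    then show "(f', z') \<in> A" using \<open>f' \<in> A1\<close> A(5) B(2) z' by blast
  qed
qed

text \<open>The complement is carried through the induction, since analytic sets are not closed
  under complements in general.\<close>

lemma Borel_analytic:
  fixes A :: "((nat \<Rightarrow> bool) \<times> ('f::zero) bseq) set"
  assumes "A \<in> borel_sets (prod_topology cantor_top Einf_top)"
  shows "A \<subseteq> UNIV \<times> Blocks \<and> analytic A"
proof -
  define T where "T = (prod_topology cantor_top Einf_top :: ((nat \<Rightarrow> bool) \<times> 'f bseq) topology)"
  have "topspace (product_topology (\<lambda>_. discrete_topology Evec) (UNIV::nat set)) \<inter> Blocks = (Blocks :: 'f bseq set)"
    by (auto simp: PiE_iff Blocks_def is_block_def)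
  then have top: "topspace T = UNIV \<times> Blocks"
    by (simp add: T_def cantor_top_def Einf_top_def)
  have "A \<in> sigma_sets (topspace T) {S. openin T S}" using assms by (simp add: borel_sets_def T_def)
  then have "A \<subseteq> topspace T \<and> analytic A \<and> analytic (topspace T - A)"
  proof (induction rule: sigma_sets.induct)
    case (Basic A)
    then have O: "openin T A" by simp
    \<comment> \<open>The witness \<open>b 0\<close> is the length of initial segments that fix a
      cylinder about \<open>(f, z)\<close> inside the open set.\<close>
    define C where "C b f z \<longleftrightarrow> (\<forall>f' z'. z' \<in> Blocks \<longrightarrow> ini f' (b 0) = ini f (b 0) \<longrightarrow>
      ini z' (b 0) = ini z (b 0) \<longrightarrow> (f', z') \<in> A)" for b :: "nat \<Rightarrow> nat" and f z
    have "seq_closed C"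
      unfolding seq_closed_def
    proof (intro allI impI)
      fix b f and z :: "'f bseq"
      assume z: "z \<in> Blocks" and lim: "\<forall>M. \<exists>b' f' z'. z' \<in> Blocks \<and> ini b' M = ini b M \<and>
        ini f' M = ini f M \<and> ini z' M = ini z M \<and> C b' f' z'"
      obtain b' f' z' where l: "ini b' (Suc (b 0)) = ini b (Suc (b 0))" "ini f' (Suc (b 0)) = ini f (Suc (b 0))"
        "ini z' (Suc (b 0)) = ini z (Suc (b 0))" "C b' f' z'" using lim by blast
      have "b' 0 = b 0" "ini f' (b 0) = ini f (b 0)" "ini z' (b 0) = ini z (b 0)"
        using ini_eqD[OF l(1)] ini_eqD[OF l(2)] ini_eqD[OF l(3)] by simp_all
      then show "C b f z" using l(4) unfolding C_def by metis
    qed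
    moreover have "(f, z) \<in> A \<longleftrightarrow> (\<exists>b. C b f z)" if "z \<in> Blocks" for f z
    proof
      assume "(f, z) \<in> A"
      then obtain n where "\<forall>f' z'. z' \<in> Blocks \<longrightarrow> ini f' n = ini f n \<longrightarrow> ini z' n = ini z n \<longrightarrow> (f', z') \<in> A"
        using openin_cylinder[OF O[unfolded T_def]] by blast
      then show "\<exists>b. C b f z" by (intro exI[of _ "\<lambda>_. n"]) (simp only: C_def simp_thms)
    qed (use that in \<open>auto simp: C_def\<close>)
    ultimately have an: "analytic A" unfolding analytic_def by blast
    define D where "D b f z \<longleftrightarrow> (f, z) \<notin> A" for b :: "nat \<Rightarrow> nat" and f z
    have "seq_closed D"
      unfolding seq_closed_def
    proof (intro allI impI)
      fix b f and z :: "'f bseq"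
      assume z: "z \<in> Blocks" and lim: "\<forall>M. \<exists>b' f' z'. z' \<in> Blocks \<and> ini b' M = ini b M \<and>
        ini f' M = ini f M \<and> ini z' M = ini z M \<and> D b' f' z'"
      show "D b f z"
        unfolding D_def using openin_cylinder[OF O[unfolded T_def], of f z] lim unfolding D_def by blast
    qed
    then have "analytic (topspace T - A)"
      unfolding analytic_def by (intro exI[of _ D]) (auto simp: D_def top)
    then show ?case using an openin_subset[OF O] by blast
  next
    case Empty
    have "seq_closed (\<lambda>_ _ _. False)" "seq_closed (\<lambda>_ _ _. True)"
      by (auto simp: seq_closed_def)
    then show ?case unfolding analytic_def
      by (intro conjI) (auto simp: top intro: exI[of _ "\<lambda>_ _ _. False"] exI[of _ "\<lambda>_ _ _. True"])
  next
    case (Compl A)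
    then show ?case by (simp add: double_diff)
  next
    case (Union A)
    have "topspace T - (\<Union>i. A i) = (\<Inter>i. topspace T - A i)" by auto
    then show ?case
      using Union analytic_Union[of A] analytic_Inter[of "\<lambda>i. topspace T - A i"] by auto
  qed
  then show ?thesis using top by blast
qed

theorem theorem6p4:
  fixes U :: "('f::{field,countable}) bseq set"
    and A :: "((nat \<Rightarrow> bool) \<times> 'f bseq) set"
  assumes "strategic U" and "pplus_filter U"
    and "A \<in> borel_sets (prod_topology cantor_top Einf_top)"
  shows "perfectly_strat_Ramsey U A"
  unfolding perfectly_strat_Ramsey_def
proof (intro allI impI)
  fix x0 :: "'f vec list" and X p
  assume x0: "is_fin_block x0" and X: "X \<in> U" and p: "perfect_tree p"
  interpret strategic_pplus U using assms(1,2) by unfold_locales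
  have xF: "x0 \<in> FBlocks" using x0 by (simp add: FBlocks_def)
  have AB: "A \<subseteq> UNIV \<times> Blocks" using Borel_analytic[OF assms(3)] by blast
  obtain C where C: "seq_closed C" "\<And>f z. z \<in> Blocks \<Longrightarrow> (f, z) \<in> A \<longleftrightarrow> (\<exists>b. C b f z)"
    using Borel_analytic[OF assms(3)] unfolding analytic_def by blast
  obtain Y q where Y: "Y \<in> restr U X" and q: "perfect_tree q" "q \<subseteq> p"
    and alt: "(\<exists>\<sigma>. \<forall>f\<in>branches q. \<forall>z\<in>outcomes_F x0 Y \<sigma>. \<not> (\<exists>b. C b f z)) \<or>
     (\<forall>f\<in>branches q. \<exists>\<alpha>. II_strategy_G x0 Y \<alpha> \<and> (\<forall>z\<in>outcomes_G x0 Y \<alpha>. \<exists>b. C b f z))"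
    using analytic_dichotomy[OF C(1) xF X p] by blast
  \<comment> \<open>\<open>C\<close> represents \<open>A\<close> only at block sequences, so the
    outcomes of II have to be recognized as such before membership in the slice can be
    concluded.\<close>
  have GB: "z \<in> Blocks" if \<alpha>: "II_strategy_G x0 Y \<alpha>" and z: "z \<in> outcomes_G x0 Y \<alpha>" for \<alpha> z
  proof -
    obtain Ys where Ys: "Ys \<in> I_plays_G Y" "z = app x0 (II_moves \<alpha> Ys)"
      using z by (auto simp: outcomes_G_def)
    show ?thesis
      unfolding Ys(2)
    proof (rule app_Blocks[OF xF])
      show "II_moves \<alpha> Ys k \<in> Evec" for k
        using \<alpha> Ys(1) bspan_Evec[of "Ys k"] unfolding II_strategy_G_def I_plays_G_def by blast
    qed (use \<alpha> Ys(1) in \<open>auto simp: II_strategy_G_def\<close>)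
  qed
  from alt have "(\<exists>\<sigma>. branches q \<times> outcomes_F x0 Y \<sigma> \<inter> A = {}) \<or>
    (\<forall>f\<in>branches q. \<exists>\<alpha>. II_strategy_G x0 Y \<alpha> \<and> outcomes_G x0 Y \<alpha> \<subseteq> slice A f)"
  proof
    assume "\<exists>\<sigma>. \<forall>f\<in>branches q. \<forall>z\<in>outcomes_F x0 Y \<sigma>. \<not> (\<exists>b. C b f z)"
    then obtain \<sigma> where "\<forall>f\<in>branches q. \<forall>z\<in>outcomes_F x0 Y \<sigma>. \<not> (\<exists>b. C b f z)" by blast
    then have "branches q \<times> outcomes_F x0 Y \<sigma> \<inter> A = {}" using C(2) AB by blast
    then show ?thesis by blast
  next
    assume G: "\<forall>f\<in>branches q. \<exists>\<alpha>. II_strategy_G x0 Y \<alpha> \<and> (\<forall>z\<in>outcomes_G x0 Y \<alpha>. \<exists>b. C b f z)"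
    have "\<exists>\<alpha>. II_strategy_G x0 Y \<alpha> \<and> outcomes_G x0 Y \<alpha> \<subseteq> slice A f" if f: "f \<in> branches q" for f
    proof -
      obtain \<alpha> where \<alpha>: "II_strategy_G x0 Y \<alpha>" "\<forall>z\<in>outcomes_G x0 Y \<alpha>. \<exists>b. C b f z" using G f by blast
      have "outcomes_G x0 Y \<alpha> \<subseteq> slice A f"
        using C(2) GB[OF \<alpha>(1)] \<alpha>(2) by (auto simp: slice_def)
      then show ?thesis using \<alpha>(1) by blast
    qed
    then show ?thesis by blast
  qed
  then show "\<exists>Y\<in>restr U X. \<exists>q. perfect_tree q \<and> q \<subseteq> p \<and>
    ((\<exists>\<sigma>. branches q \<times> outcomes_F x0 Y \<sigma> \<inter> A = {}) \<or>
     (\<forall>f\<in>branches q. \<exists>\<alpha>. II_strategy_G x0 Y \<alpha> \<and> outcomes_G x0 Y \<alpha> \<subseteq> slice A f))"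
    using Y q by blast
qed

end
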